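(* Let $H$ be a complex Hilbert space, let $f$ be a normal positive functional on $B(H)$, and let $T$ be its representing operator, i.e. the positive trace class operator on $H$ with $f(A)=\operatorname{Tr}(AT)$ for all $A\in B(H)$. (a) If $T$ has finite rank, then every normal positive functional $g$ on $B(H)$ possesses a unique $f$-Lebesgue decomposition. (b) If $T$ has infinite rank, then there exists a normal positive functional $g$ on $B(H)$ such that the $f$-Lebesgue decomposition of $g$ is not unique.
   Context: $B(H)$ is the $C^*$-algebra of all continuous linear operators on $H$. A linear functional $f$ on $B(H)$ is positive if $f(A^*A)\ge 0$ for all $A\in B(H)$; for positive functionals, $h\le f$ means $h(A^*A)\le f(A^*A)$ for all $A\in B(H)$. A functional $f$ on $B(H)$ is called normal if there is a trace class operator $T$ on $H$ with $f(A)=\operatorname{Tr}(AT)$ for all $A\in B(H)$; $T$ is called its representing operator, and $f$ is positive if and only if $T$ is positive. Let $f,g$ be positive functionals on $B(H)$. - $g$ is $f$-closable if for every sequence $(A_n)$ in $B(H)$, $f(A_n^*A_n)\to 0$ and $g((A_n-A_m)^*(A_n-A_m))\to 0$ (as $n,m\to\infty$) imply $g(A_n^*A_n)\to 0$. It is known that this is equivalent to $g$ being almost dominated by $f$: there are positive functionals $g_n$ on $B(H)$ and constants $c_n\ge 0$ with $g_n\le g_{n+1}\le g$, $g_n\le c_n f$ for all $n$, and $g_n(A)\to g(A)$ for all $A\in B(H)$. - $f$ and $g$ are mutually singular ($g$ is $f$-singular) if for every positive functional $h$ on $B(H)$, $h\le f$ and $h\le g$ imply $h=0$. - An $f$-Lebesgue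 decomposition of $g$ (Lebesgue decomposition of $g$ relative to $f$) is a pair $(g_0,g_1)$ of positive functionals on $B(H)$ such that $g=g_0+g_1$, $g_0$ is $f$-closable and $g_1$ is $f$-singular. *)

theory Defs
  imports "HOL-Analysis.Analysis" "HOL-Library.Complex_Order"
begin

text \<open>
  The order on \<^typ>\<open>complex\<close> is that of HOL-Library.Complex_Order: \<open>a \<le> b\<close> means
  \<open>Re a \<le> Re b\<close> and \<open>Im a = Im b\<close>; so \<open>0 \<le> z\<close> says that \<open>z\<close> is real and nonnegative.
\<close>

class scaleC =
  fixes scaleC :: "complex \<Rightarrow> 'a \<Rightarrow> 'a"  (infixr "*\<^sub>C" 75)

class complex_vector = scaleC + ab_group_add +
  assumes scaleC_add_right: "a *\<^sub>C (x + y) = a *\<^sub>C x + a *\<^sub>C y"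
    and scaleC_add_left: "(a + b) *\<^sub>C x = a *\<^sub>C x + b *\<^sub>C x"
    and scaleC_scaleC: "a *\<^sub>C (b *\<^sub>C x) = (a * b) *\<^sub>C x"
    and scaleC_one: "1 *\<^sub>C x = x"

lemma vector_space_scaleC:
  "vector_space (scaleC :: complex \<Rightarrow> 'a \<Rightarrow> 'a::complex_vector)"
  by unfold_locales (simp_all add: scaleC_add_right scaleC_add_left scaleC_scaleC scaleC_one)

text \<open>
  Complex Hilbert spaces of arbitrary dimension (separability is not assumed). The inner product is
  conjugate linear in its first argument; completeness and the metric structure come from
  \<^class>\<open>banach\<close>.
\<close>

class chilbert_space = complex_vector + banach +
  fixes cinner :: "'a \<Rightarrow> 'a \<Rightarrow> complex"
  assumes scaleR_scaleC: "r *\<^sub>R x = complex_of_real r *\<^sub>C x"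
    and cinner_commute: "cinner x y = cnj (cinner y x)"
    and cinner_add_right: "cinner x (y + z) = cinner x y + cinner x z"
    and cinner_scaleC_right: "cinner x (c *\<^sub>C y) = c * cinner x y"
    and cinner_ge_zero: "0 \<le> cinner x x"
    and cinner_eq_zero_iff: "cinner x x = 0 \<longleftrightarrow> x = 0"
    and norm_eq_sqrt_cinner: "norm x = sqrt (Re (cinner x x))"

lemma scaleC_zero_right: "c *\<^sub>C (0::'a::complex_vector) = 0"
  using scaleC_add_right[of c 0 "0::'a"] by simp

lemma scaleC_minus_right: "c *\<^sub>C (- (x::'a::complex_vector)) = - (c *\<^sub>C x)"
  using scaleC_add_right[of c "- x" x] by (simp add: scaleC_zero_right eq_neg_iff_add_eq_0)

lemma scaleC_diff_right: "c *\<^sub>C (x - (y::'a::complex_vector)) = c *\<^sub>C x - c *\<^sub>C y"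
  using scaleC_add_right[of c x "- y"] by (simp add: scaleC_minus_right)

lemma norm_scaleC: "norm (c *\<^sub>C (x::'a::chilbert_space)) = cmod c * norm x"
proof -
  have left: "cinner (c *\<^sub>C x) y = cnj c * cinner x y" for y
    using cinner_commute[of "c *\<^sub>C x" y] cinner_commute[of x y]
    by (simp add: cinner_scaleC_right)
  have "cinner (c *\<^sub>C x) (c *\<^sub>C x) = (c * cnj c) * cinner x x"
    by (simp add: left cinner_scaleC_right)
  also have "\<dots> = complex_of_real ((cmod c)\<^sup>2) * cinner x x"
    by (simp only: complex_norm_square)
  finally have "Re (cinner (c *\<^sub>C x) (c *\<^sub>C x)) = (cmod c)\<^sup>2 * Re (cinner x x)"
    by simp
  then show ?thesis
    by (simp add: norm_eq_sqrt_cinner real_sqrt_mult)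
qed

lemma bounded_linear_scaleC: "bounded_linear (\<lambda>x::'a::chilbert_space. c *\<^sub>C x)"
  by (rule bounded_linear_intro[where K = "cmod c"])
    (simp_all add: scaleC_add_right scaleR_scaleC scaleC_scaleC norm_scaleC mult.commute)

text \<open>The algebra \<open>B(H)\<close>; multiplication is composition of operators.\<close>

typedef (overloaded) ('h::chilbert_space) bop =
  "{A :: 'h \<Rightarrow> 'h. bounded_linear A \<and> Vector_Spaces.linear scaleC scaleC A}"
  morphisms apply_bop Abs_bop
proof
  show "(\<lambda>x. x) \<in> {A :: 'h \<Rightarrow> 'h. bounded_linear A \<and> Vector_Spaces.linear scaleC scaleC A}"
    using vector_space.linear_ident[OF vector_space_scaleC] by auto
qed

setup_lifting type_definition_bop

lemma clinear_iff:
  fixes A :: "'a::complex_vector \<Rightarrow> 'b::complex_vector"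
  shows "Vector_Spaces.linear scaleC scaleC A \<longleftrightarrow>
    (\<forall>x y. A (x + y) = A x + A y) \<and> (\<forall>c x. A (c *\<^sub>C x) = c *\<^sub>C A x)"
  by (simp add: linear_iff_module_hom module_hom_iff vector_space_scaleC
      vector_space_scaleC[THEN module_iff_vector_space[THEN iffD2]])

instantiation bop :: (chilbert_space) ring
begin

lift_definition zero_bop :: "'a bop" is "\<lambda>x. 0"
  by (simp add: clinear_iff scaleC_zero_right)

lift_definition plus_bop :: "'a bop \<Rightarrow> 'a bop \<Rightarrow> 'a bop" is "\<lambda>A B x. A x + B x"
  by (auto simp: clinear_iff scaleC_add_right intro: bounded_linear_add)

lift_definition uminus_bop :: "'a bop \<Rightarrow> 'a bop" is "\<lambda>A x. - A x"
  by (auto simp: clinear_iff scaleC_minus_right intro: bounded_linear_minus)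

lift_definition minus_bop :: "'a bop \<Rightarrow> 'a bop \<Rightarrow> 'a bop" is "\<lambda>A B x. A x - B x"
  by (auto simp: clinear_iff scaleC_diff_right intro: bounded_linear_sub)

lift_definition times_bop :: "'a bop \<Rightarrow> 'a bop \<Rightarrow> 'a bop" is "\<lambda>A B x. A (B x)"
  by (auto simp: clinear_iff intro: bounded_linear_compose)

instance
  by (standard; transfer) (auto simp: clinear_iff)

end

instantiation bop :: (chilbert_space) complex_vector
begin

lift_definition scaleC_bop :: "complex \<Rightarrow> 'a bop \<Rightarrow> 'a bop" is "\<lambda>c A x. c *\<^sub>C A x"
  by (auto simp: clinear_iff scaleC_add_right scaleC_scaleC mult.commute
      intro: bounded_linear_compose[OF bounded_linear_scaleC])

instance
  by (standard; transfer)
    (auto simp: scaleC_add_right scaleC_add_left scaleC_scaleC scaleC_one)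

end

text \<open>The adjoint exists and is unique by the Riesz representation theorem.\<close>

definition adj :: "'h::chilbert_space bop \<Rightarrow> 'h bop" where
  "adj A = (THE B. \<forall>x y. cinner (apply_bop A x) y = cinner x (apply_bop B y))"

text \<open>On a complex Hilbert space positivity includes self-adjointness.\<close>

definition positive_op :: "'h::chilbert_space bop \<Rightarrow> bool" where
  "positive_op T \<longleftrightarrow> (\<forall>x. 0 \<le> cinner x (apply_bop T x))"

text \<open>\<open>|T|\<close>, the unique positive square root of \<open>T\<^sup>* T\<close>.\<close>

definition abs_op :: "'h::chilbert_space bop \<Rightarrow> 'h bop" where
  "abs_op T = (THE P. positive_op P \<and> P * P = adj T * T)"

definition finite_rank :: "'h::chilbert_space bop \<Rightarrow> bool" where
  "finite_rank T \<longleftrightarrow> (\<exists>S. finite S \<and> range (apply_bop T) = module.span scaleC S)"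

definition orthonormal :: "'h::chilbert_space set \<Rightarrow> bool" where
  "orthonormal E \<longleftrightarrow> (\<forall>x\<in>E. \<forall>y\<in>E. cinner x y = (if x = y then 1 else 0))"

definition is_onb :: "'h::chilbert_space set \<Rightarrow> bool" where
  "is_onb E \<longleftrightarrow> orthonormal E \<and> closure (module.span scaleC E) = UNIV"

text \<open>
  The summability condition does not depend on the orthonormal basis, and for a trace class
  operator neither does the value of the sum defining the trace.
\<close>

definition trace_class :: "'h::chilbert_space bop \<Rightarrow> bool" where
  "trace_class T \<longleftrightarrow> (\<exists>E. is_onb E \<and> (\<lambda>e. cinner e (apply_bop (abs_op T) e)) summable_on E)"

definition trace :: "'h::chilbert_space bop \<Rightarrow> complex" where
  "trace T = (\<Sum>\<^sub>\<infinity>e\<in>(SOME E. is_onb E). cinner e (apply_bop T e))"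

definition positive_functional :: "('h::chilbert_space bop \<Rightarrow> complex) \<Rightarrow> bool" where
  "positive_functional f \<longleftrightarrow>
    Vector_Spaces.linear scaleC (*) f \<and> (\<forall>A. 0 \<le> f (adj A * A))"

definition functional_le ::
    "('h::chilbert_space bop \<Rightarrow> complex) \<Rightarrow> ('h bop \<Rightarrow> complex) \<Rightarrow> bool" where
  "functional_le h f \<longleftrightarrow> (\<forall>A. h (adj A * A) \<le> f (adj A * A))"

definition represents :: "'h::chilbert_space bop \<Rightarrow> ('h bop \<Rightarrow> complex) \<Rightarrow> bool" where
  "represents T f \<longleftrightarrow> trace_class T \<and> (\<forall>A. f A = trace (A * T))"

definition normal_functional :: "('h::chilbert_space bop \<Rightarrow> complex) \<Rightarrow> bool" where
  "normal_functional f \<longleftrightarrow> (\<exists>T. represents T f)"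

definition closable ::
    "('h::chilbert_space bop \<Rightarrow> complex) \<Rightarrow> ('h bop \<Rightarrow> complex) \<Rightarrow> bool" where
  "closable f g \<longleftrightarrow>
    (\<forall>A :: nat \<Rightarrow> 'h bop.
      (\<lambda>n. f (adj (A n) * A n)) \<longlonglongrightarrow> 0 \<longrightarrow>
      ((\<lambda>(n, m). g (adj (A n - A m) * (A n - A m))) \<longlongrightarrow> 0) (sequentially \<times>\<^sub>F sequentially) \<longrightarrow>
      (\<lambda>n. g (adj (A n) * A n)) \<longlonglongrightarrow> 0)"

definition mutually_singular ::
    "('h::chilbert_space bop \<Rightarrow> complex) \<Rightarrow> ('h bop \<Rightarrow> complex) \<Rightarrow> bool" where
  "mutually_singular f g \<longleftrightarrow>
    (\<forall>h. positive_functional h \<longrightarrow> functional_le h f \<longrightarrow> functional_le h g \<longrightarrow> h = (\<lambda>A. 0))"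

definition lebesgue_decomposition ::
    "('h::chilbert_space bop \<Rightarrow> complex) \<Rightarrow> ('h bop \<Rightarrow> complex) \<Rightarrow>
      ('h bop \<Rightarrow> complex) \<times> ('h bop \<Rightarrow> complex) \<Rightarrow> bool" where
  "lebesgue_decomposition f g = (\<lambda>(g0, g1).
    positive_functional g0 \<and> positive_functional g1 \<and> g = (\<lambda>A. g0 A + g1 A) \<and>
    closable f g0 \<and> mutually_singular f g1)"

end

theory Submission
  imports Defs
begin

text \<open>
  Let \<open>N\<close> be the left ideal of the operators that vanish on the range of \<open>T\<close>; thus
  \<open>f(A\<^sup>* A) = 0\<close> for \<open>A \<in> N\<close>. Every positive functional \<open>g\<close> has a greatest minorant \<open>g\<^sub>0\<close> that vanishes
  on \<open>N\<close> in this sense, and every \<open>f\<close>-closable functional vanishes on \<open>N\<close>. If \<open>T\<close> has finite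
  rank, then conversely a positive functional that vanishes on \<open>N\<close> is dominated by a multiple of \<open>f\<close>, hence is closable; so
  \<open>(g\<^sub>0, g - g\<^sub>0)\<close> is a decomposition. In any other one \<open>(k\<^sub>0, k\<^sub>1)\<close> the functional \<open>g\<^sub>0 - k\<^sub>0\<close> is a common
  minorant of \<open>k\<^sub>1\<close> and a multiple of \<open>f\<close>, hence zero.

  If \<open>T\<close> has infinite rank, choose orthonormal vectors \<open>e\<^sub>k\<close> in the range of \<open>T\<close>. Each vector functional
  \<open>A \<mapsto> \<langle>e\<^sub>k, A e\<^sub>k\<rangle>\<close> is dominated by a multiple of \<open>f\<close>, hence \<open>g(A) = \<Sum>\<^sub>k \<mu>\<^sub>k \<langle>e\<^sub>k, A e\<^sub>k\<rangle>\<close> is almost dominated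
  by \<open>f\<close> when the weights \<open>\<mu>\<^sub>k > 0\<close> are summable. Since \<open>\<Sum>\<^sub>k \<langle>e\<^sub>k, T e\<^sub>k\<rangle> \<le> f(1)\<close>, a subsequence satisfies
  \<open>\<langle>e\<^sub>k, T e\<^sub>k\<rangle> = o(\<mu>\<^sub>k\<^sup>2)\<close>. Then the vector functional \<open>g\<^sub>1\<close> of \<open>\<eta> = \<Sum>\<^sub>k \<mu>\<^sub>k e\<^sub>k\<close>, scaled by \<open>1/2\<close>, is singular
  to \<open>f\<close> although \<open>2 g\<^sub>1 \<le> g\<close>. The functionals \<open>g\<close> and \<open>g - g\<^sub>1\<close> are thus both closable, so \<open>(g, 0)\<close> and
  \<open>(g - g\<^sub>1, g\<^sub>1)\<close> are two decompositions of \<open>g\<close>.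
\<close>

section \<open>Semi-inner products\<close>

interpretation cvec: vector_space "scaleC :: complex \<Rightarrow> 'a \<Rightarrow> 'a::complex_vector"
  by (rule vector_space_scaleC)

locale semi_inner =
  fixes G :: "'a::complex_vector \<Rightarrow> 'a \<Rightarrow> complex"
  assumes add_right: "G x (y + z) = G x y + G x z"
    and scale_right: "G x (c *\<^sub>C y) = c * G x y"
    and add_left: "G (x + y) z = G x z + G y z"
    and scale_left: "G (c *\<^sub>C x) y = cnj c * G x y"
    and nonneg: "0 \<le> G x x"
begin

lemma minus_right: "G x (- y) = - G x y"
  using scale_right[of x "-1" y] by (simp add: scaleC_one)

lemma minus_left: "G (- x) y = - G x y"
  using scale_left[of "-1" x y] by (simp add: scaleC_one)

lemma diff_right: "G x (y - z) = G x y - G x z"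
  using add_right[of x y "- z"] by (simp add: minus_right)

lemma diff_left: "G (x - y) z = G x z - G y z"
  using add_left[of x "- y" z] by (simp add: minus_left)

text \<open>Positivity forces Hermitian symmetry: reality of the form at \<open>x + y\<close>
  settles the imaginary parts, reality at \<open>x + \<i> *\<^sub>C y\<close> the real
  parts.\<close>

lemma commute: "G y x = cnj (G x y)"
proof -
  have 1: "Im (G z z) = 0" for z
    using nonneg[of z] by (simp add: less_eq_complex_def)
  have "Im (G x y) + Im (G y x) = 0"
    using 1[of "x + y"] 1[of x] 1[of y] by (simp add: add_left add_right)
  moreover have "Re (G x y) - Re (G y x) = 0"
    using 1[of "x + \<i> *\<^sub>C y"] 1[of x] 1[of y]
    by (simp add: add_left add_right scale_left scale_right)
  ultimately show ?thesis by (simp add: complex_eq_iff)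
qed

definition seminorm :: "'a \<Rightarrow> real" where
  "seminorm x = sqrt (Re (G x x))"

lemma Re_nonneg: "0 \<le> Re (G x x)"
  using nonneg[of x] by (simp add: less_eq_complex_def)

lemma seminorm_nonneg [simp]: "0 \<le> seminorm x"
  by (simp add: seminorm_def Re_nonneg)

lemma seminorm_power2: "(seminorm x)\<^sup>2 = Re (G x x)"
  by (simp add: seminorm_def Re_nonneg)

lemma G_self: "G x x = complex_of_real ((seminorm x)\<^sup>2)"
  using nonneg[of x] by (simp add: seminorm_power2 complex_eq_iff less_eq_complex_def)

lemma seminorm_add_power2:
  "(seminorm (x + y))\<^sup>2 = (seminorm x)\<^sup>2 + 2 * Re (G x y) + (seminorm y)\<^sup>2"
  by (simp add: seminorm_power2 add_left add_right commute[of x y])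

lemma seminorm_scale: "seminorm (c *\<^sub>C x) = cmod c * seminorm x"
proof -
  have "G (c *\<^sub>C x) (c *\<^sub>C x) = (c * cnj c) * G x x"
    by (simp add: scale_left scale_right mult_ac)
  also have "\<dots> = complex_of_real ((cmod c)\<^sup>2) * G x x"
    by (simp only: complex_norm_square)
  finally have "Re (G (c *\<^sub>C x) (c *\<^sub>C x)) = (cmod c)\<^sup>2 * Re (G x x)" by simp
  then show ?thesis by (simp add: seminorm_def real_sqrt_mult)
qed

text \<open>Quantitative version of the fact that a shortest vector of a coset is orthogonal to the
  subspace: the excess of \<open>w\<close> over the lower bound \<open>d\<close> limits how far
  \<open>w\<close> is from being orthogonal to \<open>z\<close>.\<close>

lemma near_minimum:
  assumes d: "\<And>c. d \<le> (seminorm (w + c *\<^sub>C z))\<^sup>2"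
    and w: "(seminorm w)\<^sup>2 \<le> d + \<epsilon>\<^sup>2" and "0 \<le> \<epsilon>"
  shows "cmod (G w z) \<le> \<epsilon> * seminorm z"
proof -
  define a where "a = cmod (G w z)"
  define b where "b = seminorm z"
  have key: "2 * t * a\<^sup>2 \<le> \<epsilon>\<^sup>2 + t\<^sup>2 * a\<^sup>2 * b\<^sup>2" for t :: real
  proof -
    \<comment> \<open>The conjugate cancels the phase of \<open>G w z\<close>, so the cross term
      becomes the real number \<open>- t * a\<^sup>2\<close> and only \<open>t\<close> remains
      free.\<close>
    define c where "c = - complex_of_real t * cnj (G w z)"
    have "c * G w z = - complex_of_real (t * a\<^sup>2)"
      by (simp add: c_def a_def mult_ac complex_norm_square[symmetric] flip: of_real_power)
    then have "Re (G w (c *\<^sub>C z)) = - (t * a\<^sup>2)"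
      by (simp add: scale_right)
    moreover have "(seminorm (c *\<^sub>C z))\<^sup>2 = t\<^sup>2 * a\<^sup>2 * b\<^sup>2"
      unfolding seminorm_scale by (simp add: c_def norm_mult power_mult_distrib a_def b_def)
    ultimately have "d \<le> (seminorm w)\<^sup>2 - 2 * (t * a\<^sup>2) + t\<^sup>2 * a\<^sup>2 * b\<^sup>2"
      using d[of c] by (simp add: seminorm_add_power2)
    then show ?thesis using w by simp
  qed
  have "a\<^sup>2 \<le> (\<epsilon> * b)\<^sup>2"
  proof (cases "b = 0")
    case True
    \<comment> \<open>Without the quadratic term the inequality is linear in \<open>t\<close> and
      fails for large \<open>t\<close>; the value used below turns it into
      \<open>2 * (\<epsilon>\<^sup>2 + 1) \<le> \<epsilon>\<^sup>2\<close>.\<close>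
    have "a\<^sup>2 = 0"
    proof (rule ccontr)
      assume "a\<^sup>2 \<noteq> 0"
      then show False
        using key[of "(\<epsilon>\<^sup>2 + 1) / a\<^sup>2"] True by (simp add: add_nonneg_eq_0_iff)
          (smt (verit) zero_le_power2)
    qed
    then show ?thesis by simp
  next
    case False
    \<comment> \<open>\<open>t = 1 / b\<^sup>2\<close> minimises
      \<open>t\<^sup>2 * a\<^sup>2 * b\<^sup>2 - 2 * t * a\<^sup>2\<close>.\<close>
    then have "2 * (1 / b\<^sup>2) * a\<^sup>2 \<le> \<epsilon>\<^sup>2 + (1 / b\<^sup>2) * a\<^sup>2"
      using key[of "1 / b\<^sup>2"] by (simp add: power2_eq_square field_simps)
    then have "a\<^sup>2 / b\<^sup>2 \<le> \<epsilon>\<^sup>2" by simp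
    then show ?thesis using False by (simp add: field_simps power_mult_distrib)
  qed
  then show ?thesis
    using assms(3) by (metis a_def b_def power2_le_imp_le mult_nonneg_nonneg seminorm_nonneg)
qed

text \<open>The lower bound 0 holds for every vector, with \<open>seminorm x\<close> itself as the
  excess.\<close>

lemma Cauchy_Schwarz: "cmod (G x y) \<le> seminorm x * seminorm y"
  by (rule near_minimum[where d = 0]) simp_all

lemma seminorm_triangle: "seminorm (x + y) \<le> seminorm x + seminorm y"
proof -
  have "Re (G x y) \<le> seminorm x * seminorm y"
    using Cauchy_Schwarz[of x y] complex_Re_le_cmod[of "G x y"] by linarith
  then have "(seminorm (x + y))\<^sup>2 \<le> (seminorm x + seminorm y)\<^sup>2"
    by (simp add: seminorm_add_power2 power2_sum)
  then show ?thesis by (rule power2_le_imp_le) simp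
qed

lemma seminorm_minus: "seminorm (- x) = seminorm x"
  by (simp add: seminorm_def minus_left minus_right)

lemma seminorm_minus_commute: "seminorm (x - y) = seminorm (y - x)"
  using seminorm_minus[of "x - y"] by simp

lemma seminorm_zero [simp]: "seminorm 0 = 0"
  using seminorm_scale[of 0 0] by (simp add: scaleC_zero_right)

lemma seminorm_sum: "seminorm (sum u I) \<le> (\<Sum>i\<in>I. seminorm (u i))"
  by (induction I rule: infinite_finite_induct)
    (auto intro: order_trans[OF seminorm_triangle])

lemma seminorm_eq_if_diff_null:
  assumes "seminorm (x - y) = 0"
  shows "seminorm x = seminorm y"
  using seminorm_triangle[of "x - y" y] seminorm_triangle[of "y - x" x] assms
  by (simp add: seminorm_minus_commute[of y x])

text \<open>
  The vectors \<open>w n\<close> nearly minimise the seminorm on the coset \<open>x + M\<close>; they would converge to the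
  orthogonal projection of \<open>x\<close> if the seminorm were complete.
\<close>

lemma near_minimizers:
  assumes M: "cvec.subspace M"
  obtains w where "\<And>n::nat. w n - x \<in> M"
    "\<And>n z. z \<in> M \<Longrightarrow> cmod (G (w n) z) \<le> inverse (Suc n) * seminorm z"
    "\<And>n m. seminorm (w n - w m) \<le> inverse (Suc n) + inverse (Suc m)"
proof -
  define D where "D = (\<lambda>m. (seminorm (x + m))\<^sup>2) ` M"
  have ne: "D \<noteq> {}" using cvec.subspace_0[OF M] by (auto simp: D_def)
  have bb: "bdd_below D" by (auto simp: D_def intro!: bdd_belowI[of _ 0])
  have "\<exists>m\<in>M. (seminorm (x + m))\<^sup>2 \<le> Inf D + (inverse (Suc n))\<^sup>2" for n
    using cInf_lessD[OF ne, of "Inf D + (inverse (real (Suc n)))\<^sup>2"]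
    by (force simp: D_def)
  then obtain m where m: "\<And>n. m n \<in> M"
    "\<And>n. (seminorm (x + m n))\<^sup>2 \<le> Inf D + (inverse (Suc n))\<^sup>2"
    by metis
  define w where "w n = x + m n" for n
  have 1: "w n - x \<in> M" for n by (simp add: w_def m)
  have 2: "cmod (G (w n) z) \<le> inverse (Suc n) * seminorm z" if "z \<in> M" for n z
  proof (rule near_minimum)
    show "Inf D \<le> (seminorm (w n + c *\<^sub>C z))\<^sup>2" for c
      unfolding D_def w_def add.assoc using that m(1)[of n] M bb
      by (intro cInf_lower) (auto simp: cvec.subspace_add cvec.subspace_scale D_def)
  qed (use m(2) w_def in auto)
  \<comment> \<open>The difference lies in \<open>M\<close>, so both near minimisers are almost
    orthogonal to it; then one factor of its seminorm cancels.\<close>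
  have 3: "seminorm (w n - w k) \<le> inverse (Suc n) + inverse (Suc k)" for n k
  proof -
    let ?z = "w n - w k"
    have z: "?z \<in> M" using m(1) M by (simp add: w_def cvec.subspace_diff)
    have "(seminorm ?z)\<^sup>2 \<le> cmod (G ?z ?z)"
      using complex_Re_le_cmod[of "G ?z ?z"] by (simp add: seminorm_power2)
    also have "\<dots> \<le> cmod (G (w n) ?z) + cmod (G (w k) ?z)"
      by (metis diff_left norm_triangle_ineq4)
    also have "\<dots> \<le> (inverse (Suc n) + inverse (Suc k)) * seminorm ?z"
      using 2[OF z, of n] 2[OF z, of k] by (simp add: algebra_simps)
    finally show ?thesis
      using seminorm_nonneg[of ?z] mult_le_cancel_right[of "seminorm ?z" "seminorm ?z"]
      by (cases "seminorm ?z = 0") (auto simp: power2_eq_square)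
  qed
  show thesis using that 1 2 3 by blast
qed

end

section \<open>Bounded operators on a Hilbert space\<close>

interpretation hilbert: semi_inner "cinner :: 'h::chilbert_space \<Rightarrow> 'h \<Rightarrow> complex"
proof
  fix x y z :: 'h and c
  show "cinner (c *\<^sub>C x) y = cnj c * cinner x y"
    using cinner_commute[of "c *\<^sub>C x" y] cinner_commute[of x y] by (simp add: cinner_scaleC_right)
  show "cinner (x + y) z = cinner x z + cinner y z"
    using cinner_commute[of "x + y" z] cinner_commute[of x z] cinner_commute[of y z]
    by (simp add: cinner_add_right)
qed (simp_all add: cinner_add_right cinner_scaleC_right cinner_ge_zero)

lemma hilbert_seminorm [simp]: "hilbert.seminorm = (norm :: 'h::chilbert_space \<Rightarrow> real)"
  by (simp add: hilbert.seminorm_def norm_eq_sqrt_cinner fun_eq_iff)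

lemmas cinner_simps = hilbert.add_left hilbert.add_right hilbert.scale_left hilbert.scale_right
  hilbert.diff_left hilbert.diff_right hilbert.minus_left hilbert.minus_right

lemma cmod_cinner_le: "cmod (cinner x (y::'h::chilbert_space)) \<le> norm x * norm y"
  using hilbert.Cauchy_Schwarz[of x y] by simp

lemma cinner_self: "cinner x (x::'h::chilbert_space) = complex_of_real ((norm x)\<^sup>2)"
  using hilbert.G_self[of x] by simp

lemma bounded_bilinear_cinner: "bounded_bilinear (cinner :: 'h::chilbert_space \<Rightarrow> 'h \<Rightarrow> complex)"
proof
  show "\<exists>K. \<forall>a b::'h. norm (cinner a b) \<le> norm a * norm b * K"
    using cmod_cinner_le by (metis mult.right_neutral)
qed (simp_all add: cinner_simps scaleR_scaleC scaleR_conv_of_real)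

lemmas tendsto_cinner = bounded_bilinear.tendsto[OF bounded_bilinear_cinner]
lemmas cinner_zero_left [simp] = bounded_bilinear.zero_left[OF bounded_bilinear_cinner]
lemmas cinner_zero_right [simp] = bounded_bilinear.zero_right[OF bounded_bilinear_cinner]
lemmas cinner_sum_left = bounded_bilinear.sum_left[OF bounded_bilinear_cinner]

lemma cinner_extensionality:
  assumes "\<And>x. cinner x y = cinner x (z::'h::chilbert_space)"
  shows "y = z"
proof -
  have "cinner (y - z) (y - z) = 0" by (simp add: assms cinner_simps)
  then show ?thesis by (simp add: cinner_eq_zero_iff)
qed

lemma cauchy_inverse_Suc:
  fixes w :: "nat \<Rightarrow> 'a::{real_normed_vector}"
  assumes "\<And>n m. norm (w n - w m) \<le> C * (inverse (Suc n) + inverse (Suc m))"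
  shows "Cauchy w"
proof (rule metric_CauchyI)
  fix e :: real assume "0 < e"
  have "(\<lambda>n. C * (2 * inverse (real (Suc n)))) \<longlonglongrightarrow> C * (2 * 0)"
    by (intro tendsto_intros LIMSEQ_inverse_real_of_nat)
  then have "\<forall>\<^sub>F n in sequentially. C * (2 * inverse (real (Suc n))) < e"
    using \<open>0 < e\<close> by (auto dest: order_tendstoD)
  then obtain N where N: "C * (2 * inverse (real (Suc N))) < e"
    by (auto simp: eventually_sequentially)
  have "0 \<le> C" using assms[of 0 0] by simp
  show "\<exists>M. \<forall>m\<ge>M. \<forall>n\<ge>M. dist (w m) (w n) < e"
  proof (intro exI allI impI)
    fix m n assume "N \<le> m" "N \<le> n"
    then have "inverse (real (Suc m)) + inverse (real (Suc n)) \<le> 2 * inverse (real (Suc N))"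
      by (smt (verit) le_imp_inverse_le of_nat_0_less_iff of_nat_mono Suc_le_mono zero_less_Suc)
    then have "C * (inverse (real (Suc m)) + inverse (real (Suc n))) \<le> C * (2 * inverse (real (Suc N)))"
      using \<open>0 \<le> C\<close> by (rule mult_left_mono)
    then show "dist (w m) (w n) < e"
      using assms[of m n] N by (simp add: dist_norm)
  qed
qed

text \<open>Completeness lets the near minimisers of the norm on \<open>x + M\<close> converge. The
  limit \<open>l\<close> is the component of \<open>x\<close> orthogonal to \<open>M\<close>, so
  \<open>x - l\<close> is the projection.\<close>

lemma projection_exists:
  fixes M :: "'h::chilbert_space set"
  assumes "closed M" "cvec.subspace M"
  shows "\<exists>m\<in>M. \<forall>z\<in>M. cinner (x - m) z = 0"
proof -
  obtain w where w: "\<And>n::nat. w n - x \<in> M"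
    "\<And>n z. z \<in> M \<Longrightarrow> cmod (cinner (w n) z) \<le> inverse (Suc n) * norm z"
    "\<And>n m. norm (w n - w m) \<le> inverse (Suc n) + inverse (Suc m)"
    using hilbert.near_minimizers[OF assms(2), of x] by (metis hilbert_seminorm)
  have "Cauchy w" by (rule cauchy_inverse_Suc[where C = 1]) (use w(3) in simp)
  then obtain l where l: "w \<longlonglongrightarrow> l" by (auto simp: Cauchy_convergent_iff convergent_def)
  have "(\<lambda>n. w n - x) \<longlonglongrightarrow> l - x" by (intro tendsto_intros l)
  then have "l - x \<in> M" using assms(1) w(1) by (metis closed_sequentially)
  then have "x - l \<in> M" using cvec.subspace_neg[OF assms(2)] by fastforce
  moreover have "cinner (x - (x - l)) z = 0" if "z \<in> M" for z
  proof -
    have "(\<lambda>n. cmod (cinner (w n) z)) \<longlonglongrightarrow> cmod (cinner l z)"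
      by (intro tendsto_norm tendsto_cinner l tendsto_const)
    moreover have "(\<lambda>n. inverse (real (Suc n)) * norm z) \<longlonglongrightarrow> 0 * norm z"
      by (intro tendsto_intros LIMSEQ_inverse_real_of_nat)
    ultimately have "cmod (cinner l z) \<le> 0 * norm z"
      using w(2)[OF that] by (intro LIMSEQ_le) auto
    then show ?thesis by simp
  qed
  ultimately show ?thesis by blast
qed

text \<open>For a nonzero functional the kernel is a closed hyperplane. The component
  \<open>v\<close> of \<open>x0\<close> orthogonal to it spans a complement, so the representing
  vector must be a multiple of \<open>v\<close>.\<close>

lemma Riesz_representation:
  fixes \<phi> :: "'h::chilbert_space \<Rightarrow> complex"
  assumes "bounded_linear \<phi>" and hom: "\<And>c x. \<phi> (c *\<^sub>C x) = c * \<phi> x"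
  shows "\<exists>y. \<forall>x. \<phi> x = cinner y x"
proof (cases "\<forall>x. \<phi> x = 0")
  case True
  then show ?thesis by (intro exI[of _ 0]) simp
next
  case False
  then obtain x0 where x0: "\<phi> x0 \<noteq> 0" by blast
  interpret bounded_linear \<phi> by fact
  let ?M = "{x. \<phi> x = 0}"
  have "closed ?M"
    by (intro closed_Collect_eq continuous_intros linear_continuous_on assms)
  moreover have "cvec.subspace ?M"
    by (auto simp: cvec.subspace_def add zero hom)
  ultimately obtain m where m: "\<phi> m = 0" "\<And>z. \<phi> z = 0 \<Longrightarrow> cinner (x0 - m) z = 0"
    using projection_exists[of ?M x0] by auto
  define v where "v = x0 - m"
  have "\<phi> v \<noteq> 0" using m x0 by (simp add: v_def diff)
  then have "v \<noteq> 0" using zero by auto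
  then have vv: "cinner v v \<noteq> 0" by (simp add: cinner_eq_zero_iff)
  have "\<phi> x = cinner (cnj (\<phi> v / cinner v v) *\<^sub>C v) x" for x
  proof -
    have "\<phi> (x - (\<phi> x / \<phi> v) *\<^sub>C v) = 0" using \<open>\<phi> v \<noteq> 0\<close> by (simp add: diff hom)
    then have "cinner v (x - (\<phi> x / \<phi> v) *\<^sub>C v) = 0" using m(2) v_def by simp
    then have "cinner v x = (\<phi> x / \<phi> v) * cinner v v" by (simp add: cinner_simps)
    then show ?thesis using vv \<open>\<phi> v \<noteq> 0\<close> by (simp add: cinner_simps)
  qed
  then show ?thesis by blast
qed

section \<open>Operator algebra, adjoints and rank one operators\<close>

notation apply_bop (infixr "\<cdot>" 75)

lemma bop_bounded_linear: "bounded_linear (apply_bop A)"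
  using apply_bop[of A] by auto

lemma bop_scaleC: "A \<cdot> c *\<^sub>C x = c *\<^sub>C A \<cdot> x"
  using apply_bop[of A] by (auto simp: clinear_iff)

lemmas bop_add = linear_add[OF bounded_linear.linear[OF bop_bounded_linear]]
lemmas bop_diff = linear_diff[OF bounded_linear.linear[OF bop_bounded_linear]]
lemmas bop_zero [simp] = linear_0[OF bounded_linear.linear[OF bop_bounded_linear]]

lemma bop_eqI: "(\<And>x. A \<cdot> x = B \<cdot> x) \<Longrightarrow> A = B"
  using apply_bop_inject by blast

lemma bop_cinner_eqI: "(\<And>x y. cinner x (A \<cdot> y) = cinner x (B \<cdot> y)) \<Longrightarrow> A = B"
  by (blast intro: bop_eqI cinner_extensionality)

lemma bop_of_fun:
  assumes "bounded_linear F" "\<And>c x. F (c *\<^sub>C x) = c *\<^sub>C F x"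
  obtains A where "\<And>x. A \<cdot> x = F x"
proof
  show "Abs_bop F \<cdot> x = F x" for x
    using assms by (subst Abs_bop_inverse) (auto simp: clinear_iff linear_add bounded_linear.linear)
qed

text \<open>Only \<open>monoid_mult\<close> is claimed, not \<open>ring_1\<close>: on the zero space
  the operators 0 and 1 coincide.\<close>

instantiation bop :: (chilbert_space) monoid_mult
begin

lift_definition one_bop :: "'a bop" is "\<lambda>x. x"
  by (simp add: clinear_iff)

instance by (standard; transfer) auto

end

lemma bop_apply_simps [simp]:
  "(A + B) \<cdot> x = A \<cdot> x + B \<cdot> x" "(A - B) \<cdot> x = A \<cdot> x - B \<cdot> x" "(- A) \<cdot> x = - A \<cdot> x"
  "0 \<cdot> x = 0" "(c *\<^sub>C A) \<cdot> x = c *\<^sub>C A \<cdot> x" "(A * B) \<cdot> x = A \<cdot> B \<cdot> x" "1 \<cdot> x = x"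
  by (transfer; simp)+

lemma bop_scaleC_mult [simp]:
  "(c *\<^sub>C A) * B = c *\<^sub>C (A * B)" "A * (c *\<^sub>C B) = c *\<^sub>C (A * B)"
  for A :: "'h::chilbert_space bop"
  by (auto intro!: bop_eqI simp: bop_scaleC)

text \<open>The Riesz vector of the functional sending \<open>x\<close> to
  \<open>cinner y (A \<cdot> x)\<close> is the value of the adjoint at \<open>y\<close>; uniqueness
  of that vector gives linearity.\<close>

lemma adj_exists: "\<exists>B. \<forall>x y. cinner (A \<cdot> x) y = cinner x (B \<cdot> y)"
proof -
  have "\<exists>z. \<forall>x. cinner y (A \<cdot> x) = cinner z x" for y
  proof (rule Riesz_representation)
    show "bounded_linear (\<lambda>x. cinner y (A \<cdot> x))"
      using bounded_linear_compose[OF bounded_bilinear.bounded_linear_right[OF bounded_bilinear_cinner]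
          bop_bounded_linear] .
  qed (simp add: bop_scaleC cinner_simps)
  then obtain F where F: "\<And>x y. cinner y (A \<cdot> x) = cinner (F y) x" by metis
  have F': "cinner (A \<cdot> x) y = cinner x (F y)" for x y
    by (metis F cinner_commute)
  obtain K where K: "0 \<le> K" "\<And>x. norm (A \<cdot> x) \<le> norm x * K"
    using bounded_linear.nonneg_bounded[OF bop_bounded_linear] by blast
  have "F (x + y) = F x + F y" for x y
    by (rule cinner_extensionality) (simp add: F'[symmetric] cinner_simps)
  moreover have sc: "F (c *\<^sub>C x) = c *\<^sub>C F x" for c x
    by (rule cinner_extensionality) (simp add: F'[symmetric] cinner_simps)
  \<comment> \<open>The square of \<open>norm (F x)\<close> is the inner product of \<open>x\<close>
    with \<open>A \<cdot> F x\<close>; one factor \<open>norm (F x)\<close> cancels.\<close>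
  moreover have "norm (F x) \<le> norm x * K" for x
  proof -
    have "norm (F x) * norm (F x) = cmod (cinner (F x) (F x))"
      unfolding cinner_self norm_of_real by (simp add: power2_eq_square)
    also have "\<dots> \<le> norm x * norm (A \<cdot> F x)"
      by (metis F cmod_cinner_le)
    also have "\<dots> \<le> norm x * (norm (F x) * K)"
      by (intro mult_left_mono K) auto
    finally have "norm (F x) * norm (F x) \<le> norm (F x) * (norm x * K)" by (simp add: mult_ac)
    then show ?thesis using K(1) by (cases "F x = 0") auto
  qed
  ultimately have "bounded_linear F"
    by (intro bounded_linear_intro[where K = K]) (auto simp: scaleR_scaleC)
  then show ?thesis using bop_of_fun[of F] sc F' by metis
qed

lemma cinner_adj: "cinner (A \<cdot> x) y = cinner x (adj A \<cdot> y)"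
proof -
  obtain B where B: "\<forall>x y. cinner (A \<cdot> x) y = cinner x (B \<cdot> y)"
    using adj_exists by blast
  have "adj A = B"
    unfolding adj_def
  proof (rule the_equality)
    show "\<forall>x y. cinner (A \<cdot> x) y = cinner x (B \<cdot> y)" by (rule B)
    show "C = B" if "\<forall>x y. cinner (A \<cdot> x) y = cinner x (C \<cdot> y)" for C
      using B that by (intro bop_cinner_eqI) simp
  qed
  then show ?thesis using B by simp
qed

lemma cinner_adj': "cinner (adj A \<cdot> x) y = cinner x (A \<cdot> y)"
  by (metis cinner_adj cinner_commute)

lemma adj_eqI:
  assumes "\<And>x y. cinner (A \<cdot> x) y = cinner x (B \<cdot> y)"
  shows "adj A = B"
  by (rule bop_cinner_eqI) (metis assms cinner_adj)

lemma adj_adj [simp]: "adj (adj A) = A"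
  by (rule adj_eqI) (rule cinner_adj')

lemma adj_simps [simp]:
  "adj (A * B) = adj B * adj A" "adj (A + B) = adj A + adj B"
  "adj (A - B) = adj A - adj B" "adj (c *\<^sub>C A) = cnj c *\<^sub>C adj A" "adj 1 = 1" "adj 0 = 0"
  for A B :: "'h::chilbert_space bop"
  by ((rule adj_eqI, simp add: cinner_simps cinner_adj)+)

text \<open>This is the operator often written |x><y|, linear in \<open>x\<close> and conjugate
  linear in \<open>y\<close>.\<close>

lift_definition rank1 :: "'h::chilbert_space \<Rightarrow> 'h \<Rightarrow> 'h bop" is "\<lambda>x y z. cinner y z *\<^sub>C x"
proof -
  fix x y :: 'h
  have bound: "cmod (cinner y z) * norm x \<le> norm z * (norm y * norm x)" for z
    using mult_right_mono[OF cmod_cinner_le[of y z], of "norm x"] by (simp add: mult_ac)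
  have "bounded_linear (\<lambda>z. cinner y z *\<^sub>C x)"
    by (rule bounded_linear_intro[where K = "norm y * norm x"])
      (simp_all add: cinner_simps scaleC_add_left scaleR_scaleC scaleC_scaleC norm_scaleC bound)
  then show "bounded_linear (\<lambda>z. cinner y z *\<^sub>C x) \<and>
      Vector_Spaces.linear scaleC scaleC (\<lambda>z. cinner y z *\<^sub>C x)"
    by (simp add: clinear_iff cinner_simps scaleC_add_left)
qed

lemma rank1_apply [simp]: "rank1 x y \<cdot> z = cinner y z *\<^sub>C x"
  by transfer simp

lemma adj_rank1 [simp]: "adj (rank1 x y) = rank1 y x"
proof (rule adj_eqI)
  show "cinner (rank1 x y \<cdot> u) v = cinner u (rank1 y x \<cdot> v)" for u v
    using cinner_commute[of u y] by (simp add: cinner_simps mult.commute)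
qed

lemma rank1_mult_rank1: "rank1 x y * rank1 u v = cinner y u *\<^sub>C rank1 x v"
  by (rule bop_eqI) (simp add: cinner_simps mult.commute)

section \<open>Positive functionals\<close>

text \<open>A square root of \<open>1 - t A* A\<close>, for small \<open>t\<close>, is sought in the
  form \<open>1 - D\<close>. Squaring shows that \<open>D\<close> has to be a fixed point of the map
  taking \<open>Y\<close> to half of \<open>t A* A + Y\<^sup>2\<close>, and for small
  \<open>t\<close> this map is a contraction.\<close>

lemma adj_mult_self_bounded:
  fixes A :: "'h::chilbert_space bop"
  obtains c C where "0 \<le> c" "adj C * C = complex_of_real c *\<^sub>C 1 - adj A * A"
proof -
  define B where "B = Blinfun (apply_bop (adj A * A))"
  have B: "blinfun_apply B x = adj A \<cdot> A \<cdot> x" for x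
    unfolding B_def by (subst bounded_linear_Blinfun_apply) (auto simp: bop_bounded_linear)
  \<comment> \<open>This makes \<open>t * norm B\<close> at most 1/2, so \<open>\<Phi>\<close> maps
    the ball of radius 1/2 into itself; the added 1 covers \<open>B = 0\<close>.\<close>
  define t where "t = inverse (2 * (norm B + 1))"
  have t: "0 < t" by (simp add: t_def add_nonneg_pos)
  have tB: "t * norm B \<le> 1/2" by (simp add: t_def divide_simps) (smt (verit) norm_ge_zero)
  \<comment> \<open>Complex linearity and self-adjointness are closed conditions preserved by
    \<open>\<Phi>\<close>. Building them into \<open>S\<close> gives them to the fixed
    point.\<close>
  define S :: "('h \<Rightarrow>\<^sub>L 'h) set" where "S = {Y. norm Y \<le> 1/2 \<and>
    (\<forall>c x. blinfun_apply Y (c *\<^sub>C x) = c *\<^sub>C blinfun_apply Y x) \<and>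
    (\<forall>x y. cinner (blinfun_apply Y x) y = cinner x (blinfun_apply Y y))}"
  define \<Phi> where "\<Phi> Y = (1/2) *\<^sub>R (t *\<^sub>R B + (Y o\<^sub>L Y))" for Y :: "'h \<Rightarrow>\<^sub>L 'h"
  have "closed S"
    unfolding S_def
    by (intro closed_Collect_conj closed_Collect_all closed_Collect_eq closed_Collect_le
        continuous_intros bounded_linear.continuous_on[OF bounded_linear_scaleC]
        bounded_bilinear.continuous_on[OF bounded_bilinear_cinner])
  moreover have "0 \<in> S" by (simp add: S_def scaleC_zero_right)
  moreover have "\<Phi> ` S \<subseteq> S"
  proof (clarsimp)
    fix Y assume "Y \<in> S"
    then have Y: "norm Y \<le> 1/2" "\<And>c x. Y (c *\<^sub>C x) = c *\<^sub>C Y x"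
      "\<And>x y. cinner (Y x) y = cinner x (Y y)" by (auto simp: S_def)
    have "norm (Y o\<^sub>L Y) \<le> 1/2 * (1/2)"
      by (rule order_trans[OF norm_blinfun_compose]) (intro mult_mono Y; simp)
    then have "norm (t *\<^sub>R B + (Y o\<^sub>L Y)) \<le> 1"
      using tB t norm_triangle_ineq[of "t *\<^sub>R B" "Y o\<^sub>L Y"] unfolding norm_scaleR by linarith
    then have "norm (\<Phi> Y) \<le> 1/2" by (simp add: \<Phi>_def)
    then show "\<Phi> Y \<in> S"
      by (simp add: S_def \<Phi>_def B Y blinfun.bilinear_simps scaleR_scaleC scaleC_add_right scaleC_scaleC
          cinner_simps cinner_adj cinner_adj' bop_scaleC mult.commute)
  qed
  moreover have "dist (\<Phi> Y) (\<Phi> Z) \<le> 1/2 * dist Y Z" if "Y \<in> S" "Z \<in> S" for Y Z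
  proof -
    \<comment> \<open>\<open>Y\<close> and \<open>Z\<close> need not commute, so the difference of
      squares is split as \<open>Y (Y - Z) + (Y - Z) Z\<close>.\<close>
    have "\<Phi> Y - \<Phi> Z = (1/2) *\<^sub>R ((Y o\<^sub>L (Y - Z)) + ((Y - Z) o\<^sub>L Z))"
      by (rule blinfun_eqI) (simp add: \<Phi>_def blinfun.bilinear_simps algebra_simps)
    moreover have "norm (Y o\<^sub>L (Y - Z)) \<le> 1/2 * norm (Y - Z)"
      by (rule order_trans[OF norm_blinfun_compose]) (use that in \<open>intro mult_right_mono; auto simp: S_def\<close>)
    moreover have "norm ((Y - Z) o\<^sub>L Z) \<le> norm (Y - Z) * (1/2)"
      by (rule order_trans[OF norm_blinfun_compose]) (use that in \<open>intro mult_left_mono; auto simp: S_def\<close>)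
    ultimately show ?thesis
      using norm_triangle_ineq[of "Y o\<^sub>L (Y - Z)" "(Y - Z) o\<^sub>L Z"] by (simp add: dist_norm)
  qed
  ultimately have "\<exists>!Y\<in>S. \<Phi> Y = Y"
    by (intro Banach_fix[where c = "1/2"]) (auto simp: complete_eq_closed)
  then obtain Y where Y: "Y \<in> S" "\<Phi> Y = Y" by blast
  obtain D where D: "\<And>x. D \<cdot> x = Y x"
    using bop_of_fun[of Y] Y(1) by (auto simp: S_def blinfun.bounded_linear_right)
  have "adj D = D"
    by (rule adj_eqI) (use Y(1) in \<open>simp add: D S_def\<close>)
  have fixpoint: "2 *\<^sub>R Y x = t *\<^sub>R (adj A \<cdot> A \<cdot> x) + Y (Y x)" for x
    by (subst Y(2)[symmetric], subst \<Phi>_def) (simp add: blinfun.bilinear_simps B)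
  define r where "r = complex_of_real (sqrt (1 / t))"
  have rr: "cnj r * r = complex_of_real (1/t)"
    using t by (simp add: r_def flip: of_real_mult)
  have "adj (r *\<^sub>C (1 - D)) * (r *\<^sub>C (1 - D)) = complex_of_real (1/t) *\<^sub>C ((1 - D) * (1 - D))"
    using rr by (simp add: \<open>adj D = D\<close> scaleC_scaleC mult.commute[of r])
  also have "(1 - D) * (1 - D) = 1 - complex_of_real t *\<^sub>C (adj A * A)"
  proof (rule bop_eqI)
    show "((1 - D) * (1 - D)) \<cdot> x = (1 - complex_of_real t *\<^sub>C (adj A * A)) \<cdot> x" for x
      using fixpoint[of x] by (simp add: D blinfun.bilinear_simps scaleR_scaleC[symmetric])
        (simp add: algebra_simps scaleR_2)
  qed
  also have "complex_of_real (1/t) *\<^sub>C \<dots> = complex_of_real (1/t) *\<^sub>C 1 - adj A * A"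
    using t by (simp add: scaleC_diff_right scaleC_scaleC scaleC_one flip: of_real_mult)
  finally show thesis using t by (intro that[of "1/t" "r *\<^sub>C (1 - D)"]) auto
qed

lemma inverse_Suc_le_one: "inverse (real (Suc n)) \<le> 1"
  by (simp add: inverse_eq_divide)

section \<open>Positive functionals and their seminorms\<close>

lemma functional_linear_iff:
  fixes f :: "'a::complex_vector \<Rightarrow> complex"
  shows "Vector_Spaces.linear scaleC (*) f \<longleftrightarrow>
    (\<forall>x y. f (x + y) = f x + f y) \<and> (\<forall>c x. f (c *\<^sub>C x) = c * f x)"
proof -
  have "vector_space ((*) :: complex \<Rightarrow> complex \<Rightarrow> complex)"
    by unfold_locales (simp_all add: algebra_simps)
  then show ?thesis
    by (simp add: linear_iff_module_hom module_hom_iff vector_space_scaleC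
      module_iff_vector_space[THEN iffD2])
qed

locale pos_functional =
  fixes h :: "'h::chilbert_space bop \<Rightarrow> complex"
  assumes positive: "positive_functional h"
begin

lemma add: "h (A + B) = h A + h B"
  and scale: "h (c *\<^sub>C A) = c * h A"
  using positive by (auto simp: positive_functional_def functional_linear_iff)

lemma minus: "h (- A) = - h A"
  using scale[of "-1" A] by simp

lemma diff: "h (A - B) = h A - h B"
  using add[of A "- B"] by (simp add: minus)

lemma zero [simp]: "h 0 = 0"
  using diff[of 0 0] by simp

lemma sum: "h (sum F I) = (\<Sum>i\<in>I. h (F i))"
  by (induction I rule: infinite_finite_induct) (simp_all add: add)

text \<open>The form of the GNS construction: its Cauchy-Schwarz inequality and its seminorm carry
  all later estimates.\<close>

sublocale semi_inner "\<lambda>A B. h (adj A * B)"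
  using positive
  by unfold_locales (simp_all add: positive_functional_def algebra_simps add scale)

text \<open>Left multiplication is bounded in the GNS seminorm because \<open>c - A* A\<close> has
  the form \<open>C* C\<close>: positivity of \<open>h\<close> at \<open>C * X\<close> is the
  claimed inequality.\<close>

lemma seminorm_mult_bounded:
  obtains c where "0 \<le> c" "\<And>X. seminorm (A * X) \<le> c * seminorm X"
proof -
  obtain c C where c: "0 \<le> c" "adj C * C = complex_of_real c *\<^sub>C 1 - adj A * A"
    using adj_mult_self_bounded by blast
  have "seminorm (A * X) \<le> sqrt c * seminorm X" for X
  proof -
    have "adj (C * X) * (C * X) = adj X * (adj C * C) * X" by (simp add: mult.assoc)
    also have "\<dots> = complex_of_real c *\<^sub>C (adj X * X) - adj (A * X) * (A * X)"
      by (simp add: c(2) algebra_simps)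
    finally have "(seminorm (A * X))\<^sup>2 \<le> c * (seminorm X)\<^sup>2"
      using Re_nonneg[of "C * X"] by (simp add: diff scale seminorm_power2 del: adj_simps)
    then have "(seminorm (A * X))\<^sup>2 \<le> (sqrt c * seminorm X)\<^sup>2"
      using c(1) by (simp add: power_mult_distrib)
    then show ?thesis by (rule power2_le_imp_le) (simp add: c(1))
  qed
  then show thesis using c(1) by (intro that[of "sqrt c"]) auto
qed

lemma Cauchy_Schwarz_one: "cmod (h A) \<le> seminorm 1 * seminorm A"
  using Cauchy_Schwarz[of 1 A] by simp

lemma eq_zero_if_seminorm_zero:
  assumes "\<And>A. seminorm A = 0"
  shows "h = (\<lambda>A. 0)"
  using Cauchy_Schwarz_one by (simp add: assms fun_eq_iff)

end

lemma functional_le_iff: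
  assumes "positive_functional h" "positive_functional g"
  shows "functional_le h g \<longleftrightarrow> (\<forall>A. Re (h (adj A * A)) \<le> Re (g (adj A * A)))"
  using assms by (auto simp: functional_le_def positive_functional_def less_eq_complex_def)

lemma positive_functional_compression:
  assumes "positive_functional h"
  shows "positive_functional (\<lambda>A. h (adj X * (A * X)))"
proof -
  interpret pos_functional h by standard fact
  have "0 \<le> h (adj X * (adj A * A * X))" for A
    using nonneg[of "A * X"] by (simp add: mult.assoc)
  then show ?thesis
    by (simp add: positive_functional_def functional_linear_iff algebra_simps add scale)
qed

lemma positive_functional_limit:
  assumes "\<And>n::nat. positive_functional (h n)" and lim: "\<And>A. (\<lambda>n. h n A) \<longlonglongrightarrow> g A"
  shows "positive_functional g"
proof -
  interpret pos_functional "h n" for n by standard (rule assms)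
  have "g (A + B) = g A + g B" for A B
    by (rule LIMSEQ_unique[OF lim]) (simp add: add tendsto_add lim)
  moreover have "g (c *\<^sub>C A) = c * g A" for c A
    by (rule LIMSEQ_unique[OF lim]) (simp add: scale tendsto_mult lim)
  moreover have "0 \<le> g (adj A * A)" for A
  proof -
    have h: "0 \<le> Re (h n (adj A * A))" "Im (h n (adj A * A)) = 0" for n
      using nonneg[of n A] by (auto simp: less_eq_complex_def)
    have "0 \<le> Re (g (adj A * A))"
      by (rule LIMSEQ_le_const[OF tendsto_Re[OF lim]]) (use h in auto)
    moreover have "Im (g (adj A * A)) = 0"
      using tendsto_Im[OF lim, of "adj A * A"] h by (simp add: LIMSEQ_const_iff)
    ultimately show ?thesis by (simp add: less_eq_complex_def)
  qed
  ultimately show ?thesis by (simp add: positive_functional_def functional_linear_iff)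
qed

text \<open>
  In the GNS representation of \<open>g\<close> with cyclic vector \<open>\<xi>\<close>, the functional \<open>g\<^sub>0\<close> is the vector
  functional of the projection of \<open>\<xi>\<close> onto the orthogonal complement of \<open>N \<xi>\<close>; the sequence \<open>X\<close>
  approximates this projection from within the algebra.
\<close>

theorem greatest_minorant_vanishing_on_left_ideal:
  fixes g :: "'h::chilbert_space bop \<Rightarrow> complex"
  assumes "positive_functional g"
    and N: "cvec.subspace N" and ideal: "\<And>A B. B \<in> N \<Longrightarrow> A * B \<in> N"
  obtains g\<^sub>0 where "positive_functional g\<^sub>0" "functional_le g\<^sub>0 g"
    "\<And>A. A \<in> N \<Longrightarrow> g\<^sub>0 (adj A * A) = 0"
    "\<And>h. positive_functional h \<Longrightarrow> functional_le h g \<Longrightarrow> (\<And>A. A \<in> N \<Longrightarrow> h (adj A * A) = 0)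
      \<Longrightarrow> functional_le h g\<^sub>0"
proof -
  interpret g: pos_functional g by standard fact
  obtain X where X: "\<And>n::nat. X n - 1 \<in> N"
    "\<And>n Z. Z \<in> N \<Longrightarrow> cmod (g (adj (X n) * Z)) \<le> inverse (Suc n) * g.seminorm Z"
    "\<And>n m. g.seminorm (X n - X m) \<le> inverse (Suc n) + inverse (Suc m)"
    using g.near_minimizers[OF N, of 1] by metis
  define L where "L n A = g (adj (X n) * (A * X n))" for n A
  have posL: "positive_functional (L n)" for n
    unfolding L_def by (rule positive_functional_compression) fact
  have "convergent (\<lambda>n. L n A)" for A
  proof -
    obtain c where c: "0 \<le> c" "\<And>X. g.seminorm (A * X) \<le> c * g.seminorm X"
      using g.seminorm_mult_bounded by blast
    obtain c' where c': "0 \<le> c'" "\<And>X. g.seminorm (adj A * X) \<le> c' * g.seminorm X"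
      using g.seminorm_mult_bounded by blast
    \<comment> \<open>All \<open>X n\<close> lie in the same coset of \<open>N\<close>, so near
      orthogonality of \<open>X n\<close> to the left ideal applies to these products.\<close>
    have N': "B * (X n - X m) \<in> N" for B n m
    proof -
      have "(X n - 1) - (X m - 1) \<in> N" using N X(1) cvec.subspace_diff by blast
      then show ?thesis by (intro ideal) simp
    qed
    have small: "cmod (g (adj (X n) * (B * (X n - X m)))) \<le> 2 * d * inverse (Suc n)"
      if "0 \<le> d" "\<And>X. g.seminorm (B * X) \<le> d * g.seminorm X" for B d n m
    proof -
      have "g.seminorm (X n - X m) \<le> 2"
        using X(3)[of n m] inverse_Suc_le_one[of n] inverse_Suc_le_one[of m] by linarith
      then have "g.seminorm (B * (X n - X m)) \<le> d * 2"
        using that by (meson mult_left_mono order_trans)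
      then have "inverse (Suc n) * g.seminorm (B * (X n - X m)) \<le> inverse (Suc n) * (d * 2)"
        by (intro mult_left_mono) auto
      then show ?thesis
        using X(2)[OF N', of n B n m] order_trans by (fastforce simp: mult_ac)
    qed
    have "norm (L n A - L m A) \<le> (2 * (c + c')) * (inverse (Suc n) + inverse (Suc m))" for n m
    proof -
      have "L n A - L m A = g (adj (X n) * (A * (X n - X m))) + g (adj (X n - X m) * (A * X m))"
        by (simp add: L_def algebra_simps g.diff g.add)
      \<comment> \<open>Hermitian symmetry moves the difference to the right-hand factor, where the
        same estimate holds with \<open>adj A\<close> in place of \<open>A\<close>.\<close>
      also have "g (adj (X n - X m) * (A * X m)) = cnj (g (adj (X m) * (adj A * (X n - X m))))"
        using g.commute[of "X n - X m" "A * X m"] by (simp add: mult.assoc)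
      finally have "norm (L n A - L m A) \<le> cmod (g (adj (X n) * (A * (X n - X m))))
          + cmod (g (adj (X m) * (adj A * (X m - X n))))"
        using norm_triangle_ineq by (smt (verit) complex_mod_cnj g.minus minus_diff_eq mult_minus_right norm_minus_cancel)
      also have "\<dots> \<le> 2 * c * inverse (Suc n) + 2 * c' * inverse (Suc m)"
        by (intro add_mono small c c')
      also have "\<dots> \<le> (2 * (c + c')) * (inverse (Suc n) + inverse (Suc m))"
        using c(1) c'(1) by (simp add: algebra_simps)
      finally show ?thesis .
    qed
    then show ?thesis by (metis Cauchy_convergent_iff cauchy_inverse_Suc)
  qed
  then obtain g\<^sub>0 where lim: "\<And>A. (\<lambda>n. L n A) \<longlonglongrightarrow> g\<^sub>0 A"
    unfolding convergent_def by metis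
  have pos0: "positive_functional g\<^sub>0"
    by (rule positive_functional_limit[OF posL lim])
  have small: "(\<lambda>n. inverse (real (Suc n)) * d) \<longlonglongrightarrow> 0" for d
    using tendsto_mult[OF LIMSEQ_inverse_real_of_nat tendsto_const[of d]] by simp
  have LX: "L n (adj A * A) = g (adj (A * X n) * (A * X n))" for n A
    by (simp add: L_def mult.assoc)
  have AX: "A * X n - A \<in> N" for A n
    using ideal[OF X(1), of A n] by (simp add: algebra_simps)
  show thesis
  proof
    show "positive_functional g\<^sub>0" by fact
    show "functional_le g\<^sub>0 g"
      unfolding functional_le_iff[OF pos0 assms(1)]
    proof
      fix A
      obtain c where c: "0 \<le> c" "\<And>X. g.seminorm (adj A * X) \<le> c * g.seminorm X"
        using g.seminorm_mult_bounded by blast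
      have "Re (L n (adj A * A)) - (inverse (Suc n) * c)\<^sup>2 \<le> Re (g (adj A * A))" for n
      proof -
        \<comment> \<open>\<open>A\<close> is the sum of \<open>A * X n\<close> and an element of
          \<open>N\<close> almost orthogonal to it. Completing the square absorbs the cross term at
          the cost of \<open>?r\<^sup>2\<close>, which vanishes in the limit.\<close>
        let ?B = "A - A * X n" and ?r = "inverse (real (Suc n)) * c"
        have B: "?B \<in> N" using cvec.subspace_neg[OF N AX[of A n]] by simp
        have "cmod (g (adj (A * X n) * ?B)) \<le> inverse (Suc n) * g.seminorm (adj A * ?B)"
          using X(2)[OF ideal[OF B], of n "adj A"] by (simp add: mult.assoc)
        also have "\<dots> \<le> ?r * g.seminorm ?B"
          using c(2)[of ?B] by (simp add: mult.assoc mult_left_mono)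
        finally have *: "\<bar>Re (g (adj (A * X n) * ?B))\<bar> \<le> ?r * g.seminorm ?B"
          using abs_Re_le_cmod order_trans by blast
        have "(g.seminorm A)\<^sup>2 = (g.seminorm (A * X n))\<^sup>2 + 2 * Re (g (adj (A * X n) * ?B))
            + (g.seminorm ?B)\<^sup>2"
          using g.seminorm_add_power2[of "A * X n" ?B] by simp
        moreover have "0 \<le> (g.seminorm ?B - ?r)\<^sup>2" by simp
        ultimately have "(g.seminorm (A * X n))\<^sup>2 - ?r\<^sup>2 \<le> (g.seminorm A)\<^sup>2"
          using * by (simp add: power2_diff mult_ac)
        then show ?thesis by (simp add: g.seminorm_power2 LX)
      qed
      moreover have "(\<lambda>n. Re (L n (adj A * A)) - (inverse (Suc n) * c)\<^sup>2) \<longlonglongrightarrow> Re (g\<^sub>0 (adj A * A)) - 0\<^sup>2"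
        by (intro tendsto_intros lim small)
      ultimately show "Re (g\<^sub>0 (adj A * A)) \<le> Re (g (adj A * A))"
        by (intro LIMSEQ_le_const2) auto
    qed
    show "g\<^sub>0 (adj A * A) = 0" if "A \<in> N" for A
    proof -
      \<comment> \<open>For \<open>A\<close> in \<open>N\<close> the whole product
        \<open>adj A * A * X n\<close> stays in the left ideal, and \<open>X n\<close> is almost
        orthogonal to it.\<close>
      have N': "A * X n \<in> N" for n
        using cvec.subspace_add[OF N AX[of A n] that] by simp
      obtain c where c: "0 \<le> c" "\<And>X. g.seminorm (adj A * A * X) \<le> c * g.seminorm X"
        using g.seminorm_mult_bounded by blast
      have bd: "g.seminorm (X n) \<le> g.seminorm (X 0) + 2" for n
        using g.seminorm_triangle[of "X n - X 0" "X 0"] X(3)[of n 0] inverse_Suc_le_one[of n] by simp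
      have "cmod (L n (adj A * A)) \<le> inverse (Suc n) * (c * (g.seminorm (X 0) + 2))" for n
      proof -
        have "cmod (L n (adj A * A)) \<le> inverse (Suc n) * g.seminorm (adj A * A * X n)"
          using X(2)[OF ideal[OF N'[of n], of "adj A"], of n] by (simp add: L_def mult.assoc)
        also have "\<dots> \<le> inverse (Suc n) * (c * (g.seminorm (X 0) + 2))"
          using bd[of n] c by (intro mult_left_mono) (auto intro: order_trans mult_left_mono)
        finally show ?thesis .
      qed
      then have "(\<lambda>n. L n (adj A * A)) \<longlonglongrightarrow> 0"
        by (intro Lim_null_comparison[OF always_eventually small]) blast
      then show ?thesis using lim LIMSEQ_unique by blast
    qed
    show "functional_le h g\<^sub>0"
      if h: "positive_functional h" "functional_le h g" and van: "\<And>A. A \<in> N \<Longrightarrow> h (adj A * A) = 0" for h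
      unfolding functional_le_iff[OF h(1) pos0]
    proof
      fix A
      interpret h: pos_functional h by standard fact
      have "Re (h (adj A * A)) \<le> Re (L n (adj A * A))" for n
      proof -
        \<comment> \<open>A functional vanishing on \<open>N\<close> does not distinguish
          \<open>A * X n\<close> from \<open>A\<close>; so \<open>h \<le> g\<close> at
          \<open>A * X n\<close> already compares \<open>h\<close> at \<open>A\<close> with
          \<open>L n\<close>.\<close>
        have "h.seminorm (A * X n - A) = 0" using van[OF AX] by (simp add: h.seminorm_def del: adj_simps)
        then have "h.seminorm (A * X n) = h.seminorm A" by (rule h.seminorm_eq_if_diff_null)
        then have "(h.seminorm (A * X n))\<^sup>2 = (h.seminorm A)\<^sup>2" by simp
        then show ?thesis
          using h(2) functional_le_iff[OF h(1) assms(1)] unfolding h.seminorm_power2 LX by metis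
      qed
      then show "Re (h (adj A * A)) \<le> Re (g\<^sub>0 (adj A * A))"
        by (intro LIMSEQ_le_const[OF tendsto_Re[OF lim]]) auto
    qed
  qed
qed

section \<open>Orthonormal bases and the trace\<close>

lemma orthonormal_cinner: "orthonormal E \<Longrightarrow> x \<in> E \<Longrightarrow> y \<in> E \<Longrightarrow> cinner x y = (if x = y then 1 else 0)"
  by (simp add: orthonormal_def)

lemma orthonormal_norm:
  assumes "orthonormal E" "e \<in> E"
  shows "norm e = 1"
  using orthonormal_cinner[OF assms(1) assms(2) assms(2)] by (simp add: norm_eq_sqrt_cinner)

lemma orthonormal_subset: "orthonormal E \<Longrightarrow> F \<subseteq> E \<Longrightarrow> orthonormal F"
  unfolding orthonormal_def by blast

lemma cinner_eq_0_on_span: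
  assumes "z \<in> cvec.span F" "\<And>e. e \<in> F \<Longrightarrow> cinner x e = 0"
  shows "cinner x (z::'h::chilbert_space) = 0"
proof -
  have "cvec.subspace {z. cinner x z = 0}" by (auto simp: cvec.subspace_def cinner_simps)
  then have "cvec.span F \<subseteq> {z. cinner x z = 0}"
    by (intro cvec.span_minimal) (use assms(2) in auto)
  then show ?thesis using assms(1) by blast
qed

lemma orthonormal_independent:
  assumes "orthonormal E"
  shows "cvec.independent E"
proof
  assume "cvec.dependent E"
  then obtain e where e: "e \<in> E" "e \<in> cvec.span (E - {e})" by (auto simp: cvec.dependent_def)
  have "cinner e e = 0"
    by (rule cinner_eq_0_on_span[OF e(2)]) (use assms e(1) in \<open>auto simp: orthonormal_def\<close>)
  then show False using orthonormal_cinner[OF assms e(1) e(1)] by simp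
qed

lemma orthogonal_expansion:
  assumes "orthonormal F" "finite F" "e \<in> F"
  shows "cinner (x - (\<Sum>a\<in>F. cinner a x *\<^sub>C a)) e = 0"
proof -
  have "cinner (\<Sum>a\<in>F. cinner a x *\<^sub>C a) e = (\<Sum>a\<in>F. if a = e then cnj (cinner e x) else 0)"
    unfolding cinner_sum_left
    by (rule sum.cong) (use assms in \<open>auto simp: cinner_simps orthonormal_cinner\<close>)
  also have "\<dots> = cinner x e" using assms cinner_commute[of x e] by simp
  finally show ?thesis by (simp add: cinner_simps)
qed

text \<open>By Zorn's lemma: a nonzero vector of \<open>V\<close> orthogonal to a maximal system
  could be normalised and added to it.\<close>

lemma exists_maximal_orthonormal:
  fixes V :: "'h::chilbert_space set"
  assumes V: "cvec.subspace V" and E0: "orthonormal E0" "E0 \<subseteq> V"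
  obtains E where "orthonormal E" "E0 \<subseteq> E" "E \<subseteq> V"
    "\<And>x. x \<in> V \<Longrightarrow> (\<And>e. e \<in> E \<Longrightarrow> cinner e x = 0) \<Longrightarrow> x = 0"
proof -
  \<comment> \<open>Taking the union with \<open>E0\<close> inside the condition makes the empty set
    admissible, which the empty chain requires.\<close>
  let ?\<A> = "{E. orthonormal (E \<union> E0) \<and> E \<subseteq> V}"
  have "\<exists>M\<in>?\<A>. \<forall>X\<in>?\<A>. M \<subseteq> X \<longrightarrow> X = M"
  proof (rule subset_Zorn')
    fix C assume C: "subset.chain ?\<A> C"
    have 1: "X \<subseteq> Y \<or> Y \<subseteq> X" if "X \<in> C" "Y \<in> C" for X Y
      using C that by (auto simp: subset_chain_def)
    have 2: "orthonormal (X \<union> E0)" "X \<subseteq> V" if "X \<in> C" for X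
      using C that by (auto simp: subset_chain_def)
    have "\<exists>X. orthonormal (X \<union> E0) \<and> x \<in> X \<union> E0 \<and> y \<in> X \<union> E0"
      if xy: "x \<in> \<Union> C \<union> E0" "y \<in> \<Union> C \<union> E0" for x y
    proof -
      consider "x \<in> E0" "y \<in> E0" | X where "X \<in> C" "x \<in> X" "y \<in> E0"
        | Y where "Y \<in> C" "y \<in> Y" "x \<in> E0" | X Y where "X \<in> C" "Y \<in> C" "x \<in> X" "y \<in> Y"
        using xy by blast
      then show ?thesis
      proof cases
        case 1
        then show ?thesis using E0(1) by (intro exI[of _ "{}"]) simp
      next
        case (4 X Y)
        then show ?thesis using 1[of X Y] 2(1) by blast
      qed (use 2(1) in blast)+
    qed
    then have "orthonormal (\<Union> C \<union> E0)"
      unfolding orthonormal_def by blast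
    then show "\<Union> C \<in> ?\<A>" using 2(2) by blast
  qed
  then obtain M where M: "orthonormal (M \<union> E0)" "M \<subseteq> V"
    "\<And>X. orthonormal (X \<union> E0) \<Longrightarrow> X \<subseteq> V \<Longrightarrow> M \<subseteq> X \<Longrightarrow> X = M" by auto
  have "x = 0" if x: "x \<in> V" "\<And>e. e \<in> M \<union> E0 \<Longrightarrow> cinner e x = 0" for x
  proof (rule ccontr)
    assume "x \<noteq> 0"
    define u where "u = complex_of_real (inverse (norm x)) *\<^sub>C x"
    have uu: "cinner u u = 1"
      using \<open>x \<noteq> 0\<close> unfolding cinner_self by (simp add: u_def norm_scaleC norm_inverse)
    have u0: "cinner e u = 0" "cinner u e = 0" if "e \<in> M \<union> E0" for e
      using x(2)[OF that] cinner_commute[of x e] by (auto simp: u_def cinner_simps)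
    have "orthonormal (insert u M \<union> E0)"
      using M(1) uu u0 by (auto simp: orthonormal_def)
    moreover have "u \<in> V" by (simp add: u_def x V cvec.subspace_scale)
    ultimately have "u \<in> M" using M(2) M(3)[of "insert u M"] by auto
    then show False using u0 uu by auto
  qed
  then show thesis using M E0 by (intro that[of "M \<union> E0"]) auto
qed

text \<open>A vector of \<open>V\<close> minus its finite Fourier sum lies in \<open>V\<close> and
  is orthogonal to \<open>E\<close>, hence is zero by maximality.\<close>

lemma span_maximal_orthonormal:
  assumes V: "cvec.subspace V" and E: "orthonormal E" "E \<subseteq> V" "finite E"
    and max: "\<And>x. x \<in> V \<Longrightarrow> (\<And>e. e \<in> E \<Longrightarrow> cinner e x = 0) \<Longrightarrow> x = 0"
  shows "V = cvec.span E"
proof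
  show "cvec.span E \<subseteq> V" by (rule cvec.span_minimal) fact+
  show "V \<subseteq> cvec.span E"
  proof
    fix x assume "x \<in> V"
    let ?p = "\<Sum>a\<in>E. cinner a x *\<^sub>C a"
    have p: "?p \<in> cvec.span E" by (intro cvec.span_sum cvec.span_scale cvec.span_base)
    then have "x - ?p \<in> V" using \<open>x \<in> V\<close> V \<open>cvec.span E \<subseteq> V\<close> cvec.subspace_diff by blast
    moreover have "cinner e (x - ?p) = 0" if "e \<in> E" for e
      using orthogonal_expansion[OF E(1,3) that, of x] cinner_commute[of e "x - ?p"] by simp
    ultimately have "x - ?p = 0" by (rule max)
    then show "x \<in> cvec.span E" using p by simp
  qed
qed

lemma subspace_closure:
  fixes V :: "'h::chilbert_space set"
  assumes "cvec.subspace V"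
  shows "cvec.subspace (closure V)"
proof (rule cvec.subspaceI)
  show "0 \<in> closure V" using assms closure_subset cvec.subspace_0 by blast
next
  fix x y assume "x \<in> closure V" "y \<in> closure V"
  then obtain X Y where "\<And>n::nat. X n \<in> V" "X \<longlonglongrightarrow> x" "\<And>n::nat. Y n \<in> V" "Y \<longlonglongrightarrow> y"
    unfolding closure_sequential by auto
  then show "x + y \<in> closure V"
    unfolding closure_sequential
    by (intro exI[of _ "\<lambda>n. X n + Y n"]) (auto intro: tendsto_add cvec.subspace_add[OF assms])
next
  fix c x assume "x \<in> closure V"
  then obtain X where "\<And>n::nat. X n \<in> V" "X \<longlonglongrightarrow> x"
    unfolding closure_sequential by auto
  then show "c *\<^sub>C x \<in> closure V"
    unfolding closure_sequential
    by (intro exI[of _ "\<lambda>n. c *\<^sub>C X n"])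
      (auto intro: bounded_linear.tendsto[OF bounded_linear_scaleC] cvec.subspace_scale[OF assms])
qed

text \<open>A maximal system has dense span: the component of \<open>x\<close> orthogonal to the
  closed span is orthogonal to the whole system.\<close>

lemma orthonormal_extends_to_onb:
  assumes "orthonormal (E0 :: 'h::chilbert_space set)"
  obtains E where "is_onb E" "E0 \<subseteq> E"
proof -
  obtain E where E: "orthonormal E" "E0 \<subseteq> E" and max: "\<And>x. (\<And>e. e \<in> E \<Longrightarrow> cinner e x = 0) \<Longrightarrow> x = 0"
    using exists_maximal_orthonormal[of UNIV E0] assms by auto
  let ?V = "closure (cvec.span E)"
  have "x \<in> ?V" for x
  proof -
    obtain m where m: "m \<in> ?V" "\<And>z. z \<in> ?V \<Longrightarrow> cinner (x - m) z = 0"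
      using projection_exists[of ?V x] subspace_closure[of "cvec.span E"] by auto
    have "cinner e (x - m) = 0" if "e \<in> E" for e
      using m(2)[of e] that closure_subset[of "cvec.span E"] cvec.span_base[of e E]
        cinner_commute[of e "x - m"] by auto
    then have "x - m = 0" by (rule max)
    then show ?thesis using m(1) by simp
  qed
  then show thesis using E by (intro that[of E]) (auto simp: is_onb_def)
qed

lemma is_onb_SOME: "is_onb (SOME E :: 'h::chilbert_space set. is_onb E)"
  by (rule someI_ex) (metis orthonormal_extends_to_onb orthonormal_def empty_iff)

text \<open>The partial sum over a finite \<open>F\<close> is the inner product of \<open>y\<close>
  with the projection \<open>p\<close> of \<open>x\<close> onto the span of \<open>F\<close>. Once
  \<open>F\<close> contains \<open>G\<close>, this \<open>p\<close> is at least as close to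
  \<open>x\<close> as the approximant \<open>s\<close>.\<close>

lemma Parseval:
  assumes "is_onb E"
  shows "((\<lambda>e. cinner x e * cinner e y) has_sum cinner x y) E"
  unfolding has_sum_def
proof (rule tendstoI)
  fix \<epsilon> :: real assume "0 < \<epsilon>"
  have E: "orthonormal E" "x \<in> closure (cvec.span E)" using assms by (auto simp: is_onb_def)
  have "0 < \<epsilon> / (norm y + 1)" using \<open>0 < \<epsilon>\<close> by (simp add: add_nonneg_pos)
  then obtain s where s: "s \<in> cvec.span E" "norm (x - s) < \<epsilon> / (norm y + 1)"
    using E(2) unfolding closure_approachable by (metis dist_commute dist_norm)
  then obtain G r where G: "finite G" "G \<subseteq> E" and s_eq: "s = (\<Sum>a\<in>G. r a *\<^sub>C a)"
    unfolding cvec.span_explicit by auto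
  have sG: "s \<in> cvec.span G"
    unfolding s_eq by (intro cvec.span_sum cvec.span_scale cvec.span_base)
  have "dist (\<Sum>e\<in>F. cinner x e * cinner e y) (cinner x y) < \<epsilon>" if F: "finite F" "G \<subseteq> F" "F \<subseteq> E" for F
  proof -
    define p where "p = (\<Sum>a\<in>F. cinner a x *\<^sub>C a)"
    have "orthonormal F" using E F orthonormal_subset by blast
    then have orth: "cinner (x - p) z = 0" if "z \<in> cvec.span F" for z
      using cinner_eq_0_on_span[OF that] orthogonal_expansion F unfolding p_def by blast
    have "s \<in> cvec.span F" using sG F cvec.span_mono by blast
    moreover have "p \<in> cvec.span F"
      unfolding p_def by (intro cvec.span_sum cvec.span_scale cvec.span_base)
    ultimately have "cinner (x - p) (p - s) = 0" by (intro orth cvec.span_diff)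
    then have "(norm (x - p + (p - s)))\<^sup>2 = (norm (x - p))\<^sup>2 + (norm (p - s))\<^sup>2"
      using hilbert.seminorm_add_power2[of "x - p" "p - s"] by simp
    then have "(norm (x - p))\<^sup>2 \<le> (norm (x - s))\<^sup>2" by simp
    then have le: "norm (x - p) \<le> norm (x - s)" by (rule power2_le_imp_le) simp
    have commute: "cnj (cinner e x) = cinner x e" for e by (rule cinner_commute[symmetric])
    have "(\<Sum>e\<in>F. cinner x e * cinner e y) - cinner x y = - cinner (x - p) y"
      unfolding p_def by (simp add: cinner_simps cinner_sum_left commute)
    then have "dist (\<Sum>e\<in>F. cinner x e * cinner e y) (cinner x y) = cmod (cinner (x - p) y)"
      by (simp add: dist_norm)
    also have "\<dots> \<le> norm (x - s) * norm y"
      using cmod_cinner_le[of "x - p" y] le by (meson mult_right_mono norm_ge_zero order_trans)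
    also have "\<dots> \<le> norm (x - s) * (norm y + 1)" by (intro mult_left_mono) auto
    also have "\<dots> < \<epsilon>" using s(2) by (simp add: pos_less_divide_eq add_nonneg_pos)
    finally show ?thesis .
  qed
  then show "\<forall>\<^sub>F F in finite_subsets_at_top E. dist (\<Sum>e\<in>F. cinner x e * cinner e y) (cinner x y) < \<epsilon>"
    unfolding eventually_finite_subsets_at_top using G by (intro exI[of _ G]) auto
qed

text \<open>Parseval evaluates the trace in whatever orthonormal basis \<open>SOME\<close>
  selects.\<close>

lemma trace_rank1_mult: "trace (rank1 y w * A) = cinner w (A \<cdot> y)"
proof -
  let ?E = "SOME E :: 'a set. is_onb E"
  have "((\<lambda>e. cinner (adj A \<cdot> w) e * cinner e y) has_sum cinner (adj A \<cdot> w) y) ?E"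
    by (rule Parseval[OF is_onb_SOME])
  then show ?thesis
    unfolding trace_def by (intro infsumI) (simp add: cinner_simps cinner_adj')
qed

section \<open>Finite rank\<close>

lemma represents_rank1_mult:
  assumes "represents T f"
  shows "f (rank1 y w * A) = cinner w (A \<cdot> T \<cdot> y)"
  using assms trace_rank1_mult[of y w "A * T"] by (simp add: represents_def mult.assoc)

lemma trace_zero [simp]: "trace 0 = 0"
  by (simp add: trace_def)

lemma represents_vanishes:
  assumes "represents T f" and "\<And>y. A \<cdot> T \<cdot> y = 0"
  shows "f (adj A * A) = 0"
proof -
  have "A * T = 0" by (rule bop_eqI) (simp add: assms(2))
  then show ?thesis using assms(1) by (simp add: represents_def mult.assoc)
qed

lemma subspace_range: "cvec.subspace (range (apply_bop A))"
  by (auto simp: cvec.subspace_def image_iff intro: exI[of _ 0] bop_add[symmetric] bop_scaleC[symmetric])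

lemma subspace_annihilators: "cvec.subspace {A. \<forall>y. A \<cdot> T \<cdot> y = 0}"
  by (auto simp: cvec.subspace_def scaleC_zero_right)

lemma finite_rank_iff:
  "finite_rank T \<longleftrightarrow> (\<exists>E. finite E \<and> orthonormal E \<and> range (apply_bop T) = cvec.span E)"
proof
  assume "finite_rank T"
  then obtain S where S: "finite S" "range (apply_bop T) = cvec.span S"
    by (auto simp: finite_rank_def)
  obtain E where E: "orthonormal E" "E \<subseteq> range (apply_bop T)"
    and max: "\<And>x. x \<in> range (apply_bop T) \<Longrightarrow> (\<And>e. e \<in> E \<Longrightarrow> cinner e x = 0) \<Longrightarrow> x = 0"
    using exists_maximal_orthonormal[OF subspace_range, of "{}" T] by (auto simp: orthonormal_def)
  have "finite E"
    using cvec.independent_span_bound[OF S(1) orthonormal_independent[OF E(1)]] E(2) S(2) by simp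
  then show "\<exists>E. finite E \<and> orthonormal E \<and> range (apply_bop T) = cvec.span E"
    using span_maximal_orthonormal[OF subspace_range E] max E(1) by blast
qed (auto simp: finite_rank_def)

locale represented_functional = pos_functional f for f :: "'h::chilbert_space bop \<Rightarrow> complex" +
  fixes T :: "'h bop"
  assumes rep: "represents T f"
begin

text \<open>For \<open>x = T \<cdot> y\<close> and \<open>w = A \<cdot> x\<close> the Cauchy-Schwarz
  inequality of \<open>f\<close> is tested on \<open>rank1 w y\<close> and \<open>A\<close>: the
  form has the value \<open>(norm w)\<^sup>2\<close> there, while the seminorm of
  \<open>rank1 w y\<close> is at most \<open>norm w * q\<close>. Vector functionals of vectors in
  the range of \<open>T\<close> are thus dominated by multiples of \<open>f\<close>.\<close>

lemma range_bounded:
  assumes "x \<in> range (apply_bop T)"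
  obtains c where "0 \<le> c" "\<And>A. norm (A \<cdot> x) \<le> c * seminorm A"
proof -
  obtain y where y: "x = T \<cdot> y" using assms by blast
  define q where "q = sqrt \<bar>Re (cinner y (T \<cdot> y))\<bar>"
  have "norm (A \<cdot> x) \<le> q * seminorm A" for A
  proof (cases "A \<cdot> x = 0")
    case False
    define w where "w = A \<cdot> x"
    have "(seminorm (rank1 w y))\<^sup>2 = (norm w)\<^sup>2 * Re (cinner y (T \<cdot> y))"
      using represents_rank1_mult[OF rep, of y w "rank1 w y"]
      by (simp add: seminorm_power2 cinner_simps cinner_self mult.commute)
    also have "\<dots> \<le> (norm w * q)\<^sup>2"
      by (simp add: q_def power_mult_distrib mult_left_mono)
    finally have sn: "seminorm (rank1 w y) \<le> norm w * q"
      by (rule power2_le_imp_le) (simp add: q_def)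
    have "cmod (f (adj (rank1 w y) * A)) = (norm w)\<^sup>2"
      using represents_rank1_mult[OF rep, of y w A] by (simp add: w_def y cinner_self norm_power)
    then have "norm w * norm w \<le> seminorm (rank1 w y) * seminorm A"
      using Cauchy_Schwarz[of "rank1 w y" A] by (simp add: power2_eq_square)
    also have "\<dots> \<le> norm w * q * seminorm A" by (rule mult_right_mono[OF sn]) simp
    finally show ?thesis using False by (simp add: w_def mult.assoc)
  qed (simp add: q_def)
  then show thesis by (intro that[of q]) (simp_all add: q_def)
qed

end

text \<open>Up to an operator vanishing on the range of \<open>T\<close>, \<open>A\<close> is the
  finite sum of the \<open>rank1 (A \<cdot> e) e\<close>. On each of these \<open>h\<close> is
  controlled by \<open>norm (A \<cdot> e)\<close>, hence by the seminorm of
  \<open>f\<close>.\<close>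

lemma dominated_if_vanishing_finite_rank:
  assumes f: "positive_functional f" "represents T f" and "finite_rank T"
    and h: "positive_functional h" and vanish: "\<And>A. (\<And>y. A \<cdot> T \<cdot> y = 0) \<Longrightarrow> h (adj A * A) = 0"
  obtains c where "\<And>A. Re (h (adj A * A)) \<le> c * Re (f (adj A * A))"
proof -
  interpret f: represented_functional f T by unfold_locales fact+
  interpret h: pos_functional h by standard fact
  obtain E where E: "finite E" "orthonormal E" "range (apply_bop T) = cvec.span E"
    using assms(3) by (auto simp: finite_rank_iff)
  have "\<exists>c\<ge>0. \<forall>A. norm (A \<cdot> e) \<le> c * f.seminorm A" if "e \<in> E" for e
    using f.range_bounded[of e] E(3) that cvec.span_base by metis
  then obtain C where C: "\<And>e. e \<in> E \<Longrightarrow> 0 \<le> C e" "\<And>e A. e \<in> E \<Longrightarrow> norm (A \<cdot> e) \<le> C e * f.seminorm A"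
    by metis
  define K where "K = (\<Sum>e\<in>E. C e * h.seminorm (rank1 e e))"
  have "h.seminorm A \<le> K * f.seminorm A" for A
  proof -
    have expand: "(\<Sum>e\<in>E. rank1 (A \<cdot> e) e) \<cdot> x = A \<cdot> (\<Sum>e\<in>E. cinner e x *\<^sub>C e)" for x
      using E(1) by (induction rule: finite_induct) (simp_all add: bop_add bop_scaleC)
    have "(A - (\<Sum>e\<in>E. rank1 (A \<cdot> e) e)) \<cdot> T \<cdot> y = 0" for y
    proof -
      let ?p = "\<Sum>e\<in>E. cinner e (T \<cdot> y) *\<^sub>C e"
      have "T \<cdot> y \<in> cvec.span E" using E(3) by blast
      moreover have "?p \<in> cvec.span E"
        by (intro cvec.span_sum cvec.span_scale cvec.span_base)
      ultimately have "T \<cdot> y - ?p \<in> cvec.span E" by (rule cvec.span_diff)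
      then have "cinner (T \<cdot> y - ?p) (T \<cdot> y - ?p) = 0"
        by (rule cinner_eq_0_on_span) (rule orthogonal_expansion[OF E(2,1)])
      then have "T \<cdot> y = ?p" by (simp only: cinner_eq_zero_iff right_minus_eq)
      then show ?thesis using expand[of "T \<cdot> y"] by simp
    qed
    then have "h.seminorm (A - (\<Sum>e\<in>E. rank1 (A \<cdot> e) e)) = 0"
      using vanish by (simp add: h.seminorm_def del: adj_simps)
    then have "h.seminorm A = h.seminorm (\<Sum>e\<in>E. rank1 (A \<cdot> e) e)"
      by (rule h.seminorm_eq_if_diff_null)
    also have "\<dots> \<le> (\<Sum>e\<in>E. h.seminorm (rank1 (A \<cdot> e) e))"
      by (rule h.seminorm_sum)
    also have "\<dots> \<le> (\<Sum>e\<in>E. C e * f.seminorm A * h.seminorm (rank1 e e))"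
    proof (rule sum_mono)
      fix e assume e: "e \<in> E"
      \<comment> \<open>The operator \<open>rank1 (A \<cdot> e) e\<close> times its adjoint on the
        left is \<open>(norm (A \<cdot> e))\<^sup>2\<close> times the projection
        \<open>rank1 e e\<close>.\<close>
      have "h.seminorm (rank1 (A \<cdot> e) e) = norm (A \<cdot> e) * h.seminorm (rank1 e e)"
        using orthonormal_norm[OF E(2) e]
        by (simp add: h.seminorm_def rank1_mult_rank1 cinner_self h.scale real_sqrt_mult)
      also have "\<dots> \<le> C e * f.seminorm A * h.seminorm (rank1 e e)"
        by (intro mult_right_mono C e) simp
      finally show "h.seminorm (rank1 (A \<cdot> e) e) \<le> C e * f.seminorm A * h.seminorm (rank1 e e)" .
    qed
    also have "\<dots> = K * f.seminorm A"
      unfolding K_def sum_distrib_right by (simp add: mult_ac)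
    finally show ?thesis .
  qed
  then have "(h.seminorm A)\<^sup>2 \<le> (K * f.seminorm A)\<^sup>2" for A
    by (rule power_mono) simp
  then show thesis
    using that[of "K\<^sup>2"] unfolding power_mult_distrib h.seminorm_power2 f.seminorm_power2 by blast
qed

text \<open>Each \<open>h j\<close> tends to 0 along the sequence since it is dominated by a
  multiple of \<open>f\<close>. Letting \<open>m\<close> grow in the Cauchy condition bounds
  \<open>h j\<close> at \<open>A n\<close> uniformly in \<open>j\<close>, and this bound passes to
  the limit \<open>g\<close>.\<close>

lemma closable_if_almost_dominated:
  fixes h :: "nat \<Rightarrow> 'h::chilbert_space bop \<Rightarrow> complex"
  assumes f: "positive_functional f" and g: "positive_functional g"
    and h: "\<And>j. positive_functional (h j)" "\<And>j. functional_le (h j) g"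
    and dom: "\<And>j A. Re (h j (adj A * A)) \<le> c j * Re (f (adj A * A))"
    and lim: "\<And>A. (\<lambda>j. h j A) \<longlonglongrightarrow> g A"
  shows "closable f g"
  unfolding closable_def
proof (intro allI impI)
  interpret f: pos_functional f by standard fact
  interpret g: pos_functional g by standard fact
  interpret h: pos_functional "h j" for j by standard (rule h)
  fix A :: "nat \<Rightarrow> 'h bop"
  assume A0: "(\<lambda>n. f (adj (A n) * A n)) \<longlonglongrightarrow> 0"
    and cauchy: "((\<lambda>(n, m). g (adj (A n - A m) * (A n - A m))) \<longlongrightarrow> 0) (sequentially \<times>\<^sub>F sequentially)"
  have le: "(h.seminorm j B)\<^sup>2 \<le> (g.seminorm B)\<^sup>2" for j B
    using h(2)[of j] unfolding functional_le_iff[OF h(1) g] h.seminorm_power2 g.seminorm_power2 by blast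
  have h0: "(\<lambda>m. h.seminorm j (A m)) \<longlonglongrightarrow> 0" for j
  proof -
    have upper: "(\<lambda>m. c j * Re (f (adj (A m) * A m))) \<longlonglongrightarrow> 0"
      using tendsto_mult[OF tendsto_const[of "c j"] tendsto_Re[OF A0]] by simp
    have "(\<lambda>m. Re (h j (adj (A m) * A m))) \<longlonglongrightarrow> 0"
    proof (rule tendsto_sandwich[OF _ _ tendsto_const upper])
      show "\<forall>\<^sub>F m in sequentially. 0 \<le> Re (h j (adj (A m) * A m))"
        by (intro always_eventually allI h.Re_nonneg)
      show "\<forall>\<^sub>F m in sequentially. Re (h j (adj (A m) * A m)) \<le> c j * Re (f (adj (A m) * A m))"
        by (intro always_eventually allI dom)
    qed
    then have "(\<lambda>m. sqrt (Re (h j (adj (A m) * A m)))) \<longlonglongrightarrow> sqrt 0"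
      by (rule tendsto_real_sqrt)
    then show ?thesis by (simp add: h.seminorm_def)
  qed
  show "(\<lambda>n. g (adj (A n) * A n)) \<longlonglongrightarrow> 0"
  proof (rule tendstoI)
    fix \<epsilon> :: real assume "0 < \<epsilon>"
    \<comment> \<open>The limits in \<open>m\<close> and \<open>j\<close> only preserve weak
      inequalities, so room is left below \<open>\<epsilon>\<close>.\<close>
    define \<delta> where "\<delta> = \<epsilon> / 2"
    have \<delta>: "0 < \<delta>" "\<delta> < \<epsilon>" using \<open>0 < \<epsilon>\<close> by (auto simp: \<delta>_def)
    have "\<forall>\<^sub>F p in sequentially \<times>\<^sub>F sequentially.
        dist (case p of (n, m) \<Rightarrow> g (adj (A n - A m) * (A n - A m))) 0 < \<delta>"
      by (rule tendstoD[OF cauchy \<delta>(1)])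
    then obtain N where N: "\<And>n m. N \<le> n \<Longrightarrow> N \<le> m \<Longrightarrow> cmod (g (adj (A n - A m) * (A n - A m))) < \<delta>"
      by (auto simp: eventually_prod_sequentially simp del: adj_simps)
    have "cmod (g (adj (A n) * A n)) < \<epsilon>" if "N \<le> n" for n
    proof -
      have 1: "h.seminorm j (A n) \<le> sqrt \<delta>" for j
      proof -
        have "h.seminorm j (A n) \<le> sqrt \<delta> + h.seminorm j (A m)" if "N \<le> m" for m
        proof -
          have "(g.seminorm (A n - A m))\<^sup>2 \<le> \<delta>"
            using N[OF \<open>N \<le> n\<close> that] complex_Re_le_cmod unfolding g.seminorm_power2
            by (meson less_imp_le order_trans)
          then have "(h.seminorm j (A n - A m))\<^sup>2 \<le> (sqrt \<delta>)\<^sup>2"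
            using order_trans[OF le[of j "A n - A m"]] \<delta>(1) real_sqrt_pow2[of \<delta>] by simp
          then have "h.seminorm j (A n - A m) \<le> sqrt \<delta>"
            by (rule power2_le_imp_le) (use \<delta> in simp)
          then show ?thesis using h.seminorm_triangle[of j "A n - A m" "A m"] by simp
        qed
        moreover have "(\<lambda>m. sqrt \<delta> + h.seminorm j (A m)) \<longlonglongrightarrow> sqrt \<delta> + 0"
          by (intro tendsto_intros h0)
        ultimately show ?thesis by (intro LIMSEQ_le_const) auto
      qed
      have "Re (h j (adj (A n) * A n)) \<le> \<delta>" for j
        using power_mono[OF 1, of j 2] \<delta> by (simp add: h.seminorm_power2)
      then have "Re (g (adj (A n) * A n)) \<le> \<delta>"
        by (intro LIMSEQ_le_const2[OF tendsto_Re[OF lim]]) auto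
      moreover have "cmod (g (adj (A n) * A n)) = Re (g (adj (A n) * A n))"
        by (subst g.G_self) (simp add: g.seminorm_power2[symmetric] norm_power)
      ultimately show ?thesis using \<delta> by simp
    qed
    then show "\<forall>\<^sub>F n in sequentially. dist (g (adj (A n) * A n)) 0 < \<epsilon>"
      by (auto simp: eventually_sequentially)
  qed
qed

text \<open>Closability is tested on the constant sequence \<open>A\<close>, whose differences are
  all 0.\<close>

lemma closable_vanishes:
  assumes "closable f h" "f (adj A * A) = 0" "h 0 = 0"
  shows "h (adj A * A) = 0"
proof -
  have "(\<lambda>n::nat. h (adj A * A)) \<longlonglongrightarrow> 0"
    using assms(1)[unfolded closable_def, rule_format, of "\<lambda>_. A"] assms(2,3)
    by (simp add: case_prod_unfold)
  then show ?thesis by (simp add: LIMSEQ_const_iff)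
qed

lemma positive_functional_diff:
  assumes "positive_functional g" "positive_functional h" "functional_le h g"
  shows "positive_functional (\<lambda>A. g A - h A)"
proof -
  interpret g: pos_functional g by standard fact
  interpret h: pos_functional h by standard fact
  show ?thesis
    using assms(3) by (simp add: positive_functional_def functional_linear_iff functional_le_def
        g.add h.add g.scale h.scale algebra_simps)
qed

lemma positive_functional_add:
  assumes "positive_functional g" "positive_functional h"
  shows "positive_functional (\<lambda>A. g A + h A)"
proof -
  interpret g: pos_functional g by standard fact
  interpret h: pos_functional h by standard fact
  show ?thesis
    using g.nonneg h.nonneg by (simp add: positive_functional_def functional_linear_iff
        g.add h.add g.scale h.scale algebra_simps)
qed

lemma positive_functional_scale:
  assumes "positive_functional g" "0 \<le> c"
  shows "positive_functional (\<lambda>A. complex_of_real c * g A)"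
proof -
  interpret g: pos_functional g by standard fact
  show ?thesis
    using g.nonneg assms(2) by (simp add: positive_functional_def functional_linear_iff
        g.add g.scale algebra_simps less_eq_complex_def)
qed

lemma eq_zero_if_Re_le_0:
  assumes "positive_functional h" "\<And>A. Re (h (adj A * A)) \<le> 0"
  shows "h = (\<lambda>A. 0)"
proof -
  interpret h: pos_functional h by standard fact
  have "Re (h (adj A * A)) = 0" for A
    using assms(2)[of A] h.Re_nonneg[of A] by linarith
  then show ?thesis by (intro h.eq_zero_if_seminorm_zero) (simp add: h.seminorm_def)
qed

theorem unique_decomposition_if_finite_rank:
  assumes f: "positive_functional f" "represents T f" and "finite_rank T" and g: "positive_functional g"
  shows "\<exists>!p. lebesgue_decomposition f g p"
proof -
  interpret f: represented_functional f T by unfold_locales fact+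
  interpret g: pos_functional g by standard fact
  let ?N = "{A. \<forall>y. A \<cdot> T \<cdot> y = 0}"
  have fN: "f (adj A * A) = 0" if "A \<in> ?N" for A
    using that by (intro represents_vanishes[OF f(2)]) simp
  obtain g0 where g0: "positive_functional g0" "functional_le g0 g"
    and van0: "\<And>A. A \<in> ?N \<Longrightarrow> g0 (adj A * A) = 0"
    and max: "\<And>h. positive_functional h \<Longrightarrow> functional_le h g \<Longrightarrow>
      (\<And>A. A \<in> ?N \<Longrightarrow> h (adj A * A) = 0) \<Longrightarrow> functional_le h g0"
    by (rule greatest_minorant_vanishing_on_left_ideal[OF g subspace_annihilators[of T]]) auto
  interpret g0: pos_functional g0 by standard fact
  obtain c where c: "\<And>A. Re (g0 (adj A * A)) \<le> c * Re (f (adj A * A))"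
    using dominated_if_vanishing_finite_rank[OF f assms(3) g0(1)] van0 by blast
  have le0: "Re (g0 (adj A * A)) \<le> Re (g (adj A * A))" for A
    using g0(2) functional_le_iff[OF g0(1) g] by blast
  define g1 where "g1 = (\<lambda>A. g A - g0 A)"
  have pos1: "positive_functional g1"
    unfolding g1_def by (rule positive_functional_diff[OF g g0])
  have "closable f g0"
    by (rule closable_if_almost_dominated[OF f(1) g0(1), where h = "\<lambda>_. g0" and c = "\<lambda>_. c"])
      (use g0 c in \<open>auto simp: functional_le_def\<close>)
  moreover have "mutually_singular f g1"
    unfolding mutually_singular_def
  proof (intro allI impI)
    fix h assume h: "positive_functional h" "functional_le h f" "functional_le h g1"
    interpret h: pos_functional h by standard fact
    have hN: "h (adj A * A) = 0" if "A \<in> ?N" for A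
      using h(2) fN[OF that] h.nonneg[of A] unfolding functional_le_def by (metis order_antisym)
    \<comment> \<open>Adding \<open>h\<close> to \<open>g0\<close> gives another minorant of
      \<open>g\<close> that vanishes on \<open>?N\<close>; maximality of \<open>g0\<close> leaves no
      room for a nonzero \<open>h\<close>.\<close>
    have pos: "positive_functional (\<lambda>A. h A + g0 A)"
      by (rule positive_functional_add[OF h(1) g0(1)])
    have "functional_le (\<lambda>A. h A + g0 A) g"
      using h(3) unfolding functional_le_def g1_def by (simp add: le_diff_eq)
    then have "functional_le (\<lambda>A. h A + g0 A) g0"
      by (rule max[OF pos]) (simp add: hN van0)
    then have "Re (h (adj A * A)) \<le> 0" for A
      unfolding functional_le_iff[OF pos g0(1)] by simp
    then show "h = (\<lambda>A. 0)" by (rule eq_zero_if_Re_le_0[OF h(1)])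
  qed
  ultimately have dec: "lebesgue_decomposition f g (g0, g1)"
    by (simp add: lebesgue_decomposition_def g0 pos1) (simp add: g1_def)
  show ?thesis
  proof (rule ex1I[of _ "(g0, g1)"])
    show "lebesgue_decomposition f g (g0, g1)" by (rule dec)
    fix p assume "lebesgue_decomposition f g p"
    then obtain k0 k1 where p: "p = (k0, k1)" and k: "positive_functional k0" "positive_functional k1"
      "g = (\<lambda>A. k0 A + k1 A)" "closable f k0" "mutually_singular f k1"
      by (cases p) (auto simp: lebesgue_decomposition_def)
    interpret k0: pos_functional k0 by standard fact
    interpret k1: pos_functional k1 by standard fact
    have kN: "k0 (adj A * A) = 0" if "A \<in> ?N" for A
      using closable_vanishes[OF k(4) fN[OF that]] by simp
    have "functional_le k0 g"
      using k1.nonneg by (simp add: functional_le_def k(3))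
    then have "functional_le k0 g0" using max[OF k(1)] kN by blast
    then have pos: "positive_functional (\<lambda>A. g0 A - k0 A)"
      by (rule positive_functional_diff[OF g0(1) k(1)])
    \<comment> \<open>Dividing by \<open>d\<close> brings \<open>g0 - k0\<close> below
      \<open>f\<close> because \<open>c \<le> d\<close>, and keeps it below \<open>k1\<close>
      because \<open>1 \<le> d\<close>.\<close>
    define d where "d = max 1 c"
    have d: "1 \<le> d" "c \<le> d" by (auto simp: d_def)
    let ?h = "\<lambda>A. complex_of_real (1 / d) * (g0 A - k0 A)"
    have posh: "positive_functional ?h"
      using d by (intro positive_functional_scale pos) simp
    have "functional_le ?h f"
      unfolding functional_le_iff[OF posh f(1)]
    proof
      fix A
      have "Re (g0 (adj A * A)) - Re (k0 (adj A * A)) \<le> d * Re (f (adj A * A))"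
        using c[of A] mult_right_mono[OF d(2) f.Re_nonneg[of A]] k0.Re_nonneg[of A] by linarith
      then show "Re (?h (adj A * A)) \<le> Re (f (adj A * A))"
        using d by (simp add: field_simps)
    qed
    moreover have "functional_le ?h k1"
      unfolding functional_le_iff[OF posh k(2)]
    proof
      fix A
      have "Re (g0 (adj A * A)) - Re (k0 (adj A * A)) \<le> Re (k1 (adj A * A))"
        using le0[of A] by (simp add: k(3))
      also have "\<dots> \<le> d * Re (k1 (adj A * A))"
        using mult_right_mono[OF d(1) k1.Re_nonneg[of A]] by simp
      finally show "Re (?h (adj A * A)) \<le> Re (k1 (adj A * A))"
        using d by (simp add: field_simps)
    qed
    ultimately have "?h = (\<lambda>A. 0)"
      using k(5) posh unfolding mutually_singular_def by blast
    then have "complex_of_real (1 / d) * (g0 A - k0 A) = 0" for A by metis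
    then have "g0 = k0" using d by (auto simp: fun_eq_iff)
    then show "p = (g0, g1)" by (simp add: p g1_def k(3))
  qed
qed

section \<open>Diagonal trace class operators\<close>

lemma sum_le_sums:
  fixes F :: "nat \<Rightarrow> real"
  assumes "F sums s" "\<And>k. 0 \<le> F k"
  shows "(\<Sum>k<n. F k) \<le> s"
  using sum_le_suminf[of F "{..<n}"] assms by (auto simp: sums_iff)

lemma bop_eqI_onb:
  assumes "is_onb E" "\<And>e. e \<in> E \<Longrightarrow> A \<cdot> e = B \<cdot> e"
  shows "A = B"
proof (rule bop_cinner_eqI)
  fix x y
  have expand: "((\<lambda>e. cinner x (C \<cdot> e) * cinner e y) has_sum cinner x (C \<cdot> y)) E" for C
    using Parseval[OF assms(1), of "adj C \<cdot> x" y] by (simp add: cinner_adj')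
  have "((\<lambda>e. cinner x (A \<cdot> e) * cinner e y) has_sum cinner x (B \<cdot> y)) E"
    using expand[of B] by (rule has_sum_cong[THEN iffD1, rotated]) (simp add: assms(2))
  then show "cinner x (A \<cdot> y) = cinner x (B \<cdot> y)"
    using expand[of A] has_sum_unique by blast
qed

text \<open>The form \<open>cinner x (P \<cdot> y)\<close> is a semi-inner product, hence
  Hermitian.\<close>

lemma positive_op_symmetric:
  assumes "positive_op P"
  shows "cinner (P \<cdot> x) y = cinner x (P \<cdot> y)"
proof -
  interpret semi_inner "\<lambda>x y. cinner x (P \<cdot> y)"
    using assms by unfold_locales (simp_all add: cinner_simps bop_add bop_scaleC positive_op_def)
  show ?thesis using commute[of x y] cinner_commute[of "P \<cdot> x" y] by simp
qed

text \<open>The total weight 1 makes \<open>\<Sum>k. \<mu> k |e k><e k|\<close> a density operator;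
  it also gives the constant 1 when the vector \<open>\<eta>\<close> is compared with it.\<close>

locale diagonal_weights =
  fixes e :: "nat \<Rightarrow> 'h::chilbert_space" and \<mu> :: "nat \<Rightarrow> real"
  assumes inj_e: "inj e" and orthonormal_e: "orthonormal (range e)"
    and weight_pos: "\<And>k. 0 < \<mu> k" and weight_sums: "\<mu> sums 1"
begin

lemma cinner_e: "cinner (e j) (e k) = (if j = k then 1 else 0)"
  using orthonormal_cinner[OF orthonormal_e, of "e j" "e k"] inj_e by (simp add: inj_eq)

lemma norm_e [simp]: "norm (e k) = 1"
  using orthonormal_norm[OF orthonormal_e] by blast

lemma summable_weight: "summable (\<lambda>k. \<mu> k * c)"
  using weight_sums by (intro summable_mult2) (rule sums_summable)

lemma summable_weight_bounded:
  fixes F :: "nat \<Rightarrow> 'b::banach"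
  assumes "\<And>k. norm (F k) \<le> \<mu> k * c"
  shows "summable (\<lambda>k. norm (F k))" and "summable F"
proof -
  show "summable (\<lambda>k. norm (F k))"
    by (rule summable_comparison_test'[OF summable_weight]) (use assms in simp)
  then show "summable F" by (rule summable_norm_cancel)
qed

lemma diagonal_term_bound: "norm ((complex_of_real (\<mu> k) * cinner (e k) x) *\<^sub>C e k) \<le> \<mu> k * norm x"
  using cmod_cinner_le[of "e k" x] weight_pos[of k]
  by (simp add: norm_scaleC norm_mult mult_left_mono)

lemma diagonal_exists:
  "\<exists>S. \<forall>x. (\<lambda>k. (complex_of_real (\<mu> k) * cinner (e k) x) *\<^sub>C e k) sums (S \<cdot> x)"
proof -
  define F where "F x = (\<Sum>k. (complex_of_real (\<mu> k) * cinner (e k) x) *\<^sub>C e k)" for x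
  have F: "(\<lambda>k. (complex_of_real (\<mu> k) * cinner (e k) x) *\<^sub>C e k) sums F x" for x
    unfolding F_def by (intro summable_sums summable_weight_bounded[OF diagonal_term_bound])
  have "F (x + y) = F x + F y" for x y
    by (rule sums_unique2[OF F]) (use sums_add[OF F[of x] F[of y]] in
      \<open>simp add: cinner_simps scaleC_add_left algebra_simps\<close>)
  moreover have scale: "F (c *\<^sub>C x) = c *\<^sub>C F x" for c x
    by (rule sums_unique2[OF F]) (use bounded_linear.sums[OF bounded_linear_scaleC F[of x]] in
      \<open>simp add: cinner_simps scaleC_scaleC mult_ac\<close>)
  moreover have "norm (F x) \<le> norm x * 1" for x
  proof -
    have "norm (F x) \<le> (\<Sum>k. norm ((complex_of_real (\<mu> k) * cinner (e k) x) *\<^sub>C e k))"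
      unfolding F_def by (intro summable_norm summable_weight_bounded[OF diagonal_term_bound])
    also have "\<dots> \<le> (\<Sum>k. \<mu> k * norm x)"
      by (intro suminf_le diagonal_term_bound summable_weight summable_weight_bounded[OF diagonal_term_bound])
    also have "\<dots> = norm x * 1"
      using sums_mult2[OF weight_sums, of "norm x"] by (simp add: sums_iff)
    finally show ?thesis .
  qed
  ultimately have "bounded_linear F"
    by (intro bounded_linear_intro[where K = 1]) (auto simp: scaleR_scaleC)
  then obtain S where "\<And>x. S \<cdot> x = F x" using bop_of_fun[of F] scale by blast
  then show ?thesis using F by (intro exI[of _ S]) simp
qed

definition diagonal :: "'h bop" where
  "diagonal = (SOME S. \<forall>x. (\<lambda>k. (complex_of_real (\<mu> k) * cinner (e k) x) *\<^sub>C e k) sums (S \<cdot> x))"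

lemma diagonal_sums: "(\<lambda>k. (complex_of_real (\<mu> k) * cinner (e k) x) *\<^sub>C e k) sums (diagonal \<cdot> x)"
  using someI_ex[OF diagonal_exists] unfolding diagonal_def by blast

lemma cinner_diagonal_sums:
  "(\<lambda>k. complex_of_real (\<mu> k) * (cinner (e k) y * cinner x (A \<cdot> e k))) sums cinner x (A \<cdot> diagonal \<cdot> y)"
proof -
  have "bounded_linear (\<lambda>z. cinner x (A \<cdot> z))"
    using bounded_linear_compose[OF bounded_bilinear.bounded_linear_right[OF bounded_bilinear_cinner]
        bop_bounded_linear] .
  from bounded_linear.sums[OF this diagonal_sums[of y]] show ?thesis
    by (simp add: bop_scaleC cinner_simps mult_ac)
qed

lemma diagonal_e: "diagonal \<cdot> e k = complex_of_real (\<mu> k) *\<^sub>C e k"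
proof -
  have "(\<lambda>j. (complex_of_real (\<mu> j) * cinner (e j) (e k)) *\<^sub>C e j) sums
      ((complex_of_real (\<mu> k) * cinner (e k) (e k)) *\<^sub>C e k)"
    by (rule sums_finite[of "{k}", simplified]) (simp add: cinner_e)
  then show ?thesis using diagonal_sums[of "e k"] by (simp add: cinner_e sums_unique2)
qed

lemma diagonal_orthogonal:
  assumes "\<And>k. cinner (e k) x = 0"
  shows "diagonal \<cdot> x = 0"
  using diagonal_sums[of x] by (simp add: assms sums_unique2)

lemma positive_diagonal: "positive_op diagonal"
  unfolding positive_op_def
proof
  fix x
  have "(\<lambda>k. complex_of_real (\<mu> k) * (cinner (e k) x * cinner x (e k))) sums cinner x (diagonal \<cdot> x)"
    using cinner_diagonal_sums[of x x 1] by simp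
  moreover have "cinner (e k) x * cinner x (e k) = complex_of_real ((cmod (cinner (e k) x))\<^sup>2)" for k
    by (subst cinner_commute[of x]) (simp only: complex_norm_square)
  ultimately have sums: "(\<lambda>k. complex_of_real (\<mu> k * (cmod (cinner (e k) x))\<^sup>2)) sums cinner x (diagonal \<cdot> x)"
    by simp
  have "0 \<le> Re (cinner x (diagonal \<cdot> x))"
    by (rule sums_le[OF _ sums_zero sums_Re[OF sums]]) (simp add: weight_pos less_imp_le)
  moreover have "Im (cinner x (diagonal \<cdot> x)) = 0"
    using sums_Im[OF sums] sums_unique2[OF _ sums_zero] by fastforce
  ultimately show "0 \<le> cinner x (diagonal \<cdot> x)" by (simp add: less_eq_complex_def)
qed

lemma adj_diagonal: "adj diagonal = diagonal"
  by (rule adj_eqI) (rule positive_op_symmetric[OF positive_diagonal])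

lemma onb_cases:
  assumes E: "is_onb E" "range e \<subseteq> E" and x: "x \<in> E"
  obtains k where "x = e k" | "x \<notin> range e" "diagonal \<cdot> x = 0"
proof (cases "x \<in> range e")
  case False
  have "cinner (e k) x = 0" for k
  proof -
    have "orthonormal E" "e k \<in> E" "e k \<noteq> x" using E False by (auto simp: is_onb_def)
    then show ?thesis using orthonormal_cinner x by fastforce
  qed
  then show thesis using that(2) False diagonal_orthogonal by blast
qed (use that in blast)

text \<open>Uniqueness of the positive square root is checked on a basis extending \<open>e\<close>.
  At \<open>e k\<close> the defect \<open>y\<close> is an eigenvector of \<open>P\<close> for
  \<open>- \<mu> k\<close> if it is nonzero, which contradicts positivity; at the other basis
  vectors \<open>P \<cdot> P \<cdot> x = 0\<close>, so \<open>P \<cdot> x = 0\<close>.\<close>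

lemma abs_op_diagonal: "abs_op diagonal = diagonal"
  unfolding abs_op_def
proof (rule the_equality)
  show "positive_op diagonal \<and> diagonal * diagonal = adj diagonal * diagonal"
    by (simp add: positive_diagonal adj_diagonal)
  fix P :: "'h bop" assume P: "positive_op P \<and> P * P = adj diagonal * diagonal"
  obtain E where E: "is_onb E" "range e \<subseteq> E" using orthonormal_extends_to_onb[OF orthonormal_e] .
  have PP: "P \<cdot> P \<cdot> x = diagonal \<cdot> diagonal \<cdot> x" for x
    using arg_cong[OF conjunct2[OF P], of "\<lambda>A. A \<cdot> x"] by (simp add: adj_diagonal)
  show "P = diagonal"
  proof (rule bop_eqI_onb[OF E(1)])
    fix x assume "x \<in> E"
    then consider k where "x = e k" | "diagonal \<cdot> x = 0"
      using onb_cases[OF E] by blast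
    then show "P \<cdot> x = diagonal \<cdot> x"
    proof cases
      case (1 k)
      define y where "y = P \<cdot> e k - complex_of_real (\<mu> k) *\<^sub>C e k"
      have "P \<cdot> y = - complex_of_real (\<mu> k) *\<^sub>C y"
        by (simp add: y_def bop_diff bop_scaleC PP diagonal_e scaleC_diff_right scaleC_scaleC)
      then have "cinner y (P \<cdot> y) = - complex_of_real (\<mu> k * (norm y)\<^sup>2)"
        by (simp add: cinner_simps cinner_self)
      moreover have "0 \<le> cinner y (P \<cdot> y)" using P by (simp add: positive_op_def)
      ultimately have "\<mu> k * (norm y)\<^sup>2 \<le> 0"
        by (simp add: less_eq_complex_def del: of_real_mult)
      then have "y = 0" using weight_pos[of k] by (simp add: mult_le_0_iff)
      then show ?thesis by (simp add: 1 y_def diagonal_e)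
    next
      case 2
      have "cinner (P \<cdot> x) (P \<cdot> x) = cinner x (P \<cdot> P \<cdot> x)"
        using P by (intro positive_op_symmetric) simp
      also have "\<dots> = 0" by (simp add: PP 2)
      finally show ?thesis by (simp add: 2 cinner_eq_zero_iff)
    qed
  qed
qed

lemma trace_class_diagonal: "trace_class diagonal"
proof -
  obtain E where E: "is_onb E" "range e \<subseteq> E" using orthonormal_extends_to_onb[OF orthonormal_e] .
  have "(\<lambda>k. cinner (e k) (diagonal \<cdot> e k)) summable_on UNIV"
    using weight_pos by (intro norm_summable_imp_summable_on summable_weight_bounded[where c = 1])
      (simp add: diagonal_e cinner_simps cinner_e less_imp_le)
  then have "(\<lambda>x. cinner x (diagonal \<cdot> x)) summable_on range e"
    by (subst summable_on_reindex[OF inj_e]) (simp add: o_def)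
  moreover have "cinner x (diagonal \<cdot> x) = 0" if "x \<in> E - range e" for x
    using onb_cases[OF E, of x] that by (metis DiffE cinner_zero_right rangeI)
  ultimately have "(\<lambda>x. cinner x (diagonal \<cdot> x)) summable_on E"
    using E(2) by (subst summable_on_cong_neutral[where T = "range e"]) auto
  then show ?thesis unfolding trace_class_def abs_op_diagonal using E(1) by blast
qed

text \<open>The basis in the definition of the trace is unrelated to \<open>e\<close>. The double
  family \<open>F\<close> links the two: summing over the basis gives the weighted diagonal entries
  by Parseval, summing over \<open>k\<close> gives the terms of the trace, and absolute summability
  permits the exchange.\<close>

lemma trace_mult_diagonal: "(\<lambda>k. complex_of_real (\<mu> k) * cinner (e k) (A \<cdot> e k)) sums trace (A * diagonal)"
proof -
  define E where "E = (SOME E :: 'h set. is_onb E)"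
  have E: "is_onb E" unfolding E_def by (rule is_onb_SOME)
  obtain K where K: "\<And>x. norm (A \<cdot> x) \<le> norm x * K" "0 \<le> K"
    using bounded_linear.nonneg_bounded[OF bop_bounded_linear] by blast
  define F where "F k x = complex_of_real (\<mu> k) * (cinner (e k) x * cinner x (A \<cdot> e k))" for k x
  have row: "(F k has_sum complex_of_real (\<mu> k) * cinner (e k) (A \<cdot> e k)) E" for k
    unfolding F_def by (intro has_sum_cmult_right Parseval E)
  have sq: "((\<lambda>x. (cmod (cinner x y))\<^sup>2) has_sum (norm y)\<^sup>2) E" for y
  proof -
    have "((\<lambda>x. complex_of_real ((cmod (cinner x y))\<^sup>2)) has_sum complex_of_real ((norm y)\<^sup>2)) E"
      using Parseval[OF E, of y y] cinner_commute[of y]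
      by (simp add: cinner_self complex_norm_square mult.commute del: of_real_power)
    then show ?thesis by (simp only: has_sum_of_real_iff)
  qed
  have xy: "a * b \<le> a\<^sup>2 + b\<^sup>2" if "0 \<le> a" "0 \<le> b" for a b :: real
    using sum_squares_bound[of a b] mult_nonneg_nonneg[OF that] by linarith
  \<comment> \<open>Splitting the product into two squares gives majorants that Parseval sums over
    the basis.\<close>
  have bound: "cmod (F k x) \<le> \<mu> k * ((cmod (cinner x (e k)))\<^sup>2 + (cmod (cinner x (A \<cdot> e k)))\<^sup>2)" for k x
  proof -
    have "cmod (F k x) = \<mu> k * (cmod (cinner x (e k)) * cmod (cinner x (A \<cdot> e k)))"
      using weight_pos[of k] cinner_commute[of "e k" x] by (simp add: F_def norm_mult)
    also have "\<dots> \<le> \<mu> k * ((cmod (cinner x (e k)))\<^sup>2 + (cmod (cinner x (A \<cdot> e k)))\<^sup>2)"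
      using weight_pos[of k] xy[of "cmod (cinner x (e k))" "cmod (cinner x (A \<cdot> e k))"]
      by (intro mult_left_mono) auto
    finally show ?thesis .
  qed
  have bound_sum: "((\<lambda>x. \<mu> k * ((cmod (cinner x (e k)))\<^sup>2 + (cmod (cinner x (A \<cdot> e k)))\<^sup>2))
      has_sum \<mu> k * (1 + (norm (A \<cdot> e k))\<^sup>2)) E" for k
    using has_sum_cmult_right[OF has_sum_add[OF sq[of "e k"] sq[of "A \<cdot> e k"]]]
    by simp
  have norm_row: "(\<lambda>x. cmod (F k x)) summable_on E" for k
    using has_sum_imp_summable[OF row[of k]] unfolding summable_on_iff_abs_summable_on_complex .
  have "(\<Sum>\<^sub>\<infinity>x\<in>E. cmod (F k x)) \<le> \<mu> k * (1 + K\<^sup>2)" for k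
  proof -
    have "(\<Sum>\<^sub>\<infinity>x\<in>E. cmod (F k x)) \<le> \<mu> k * (1 + (norm (A \<cdot> e k))\<^sup>2)"
      using has_sum_mono[OF has_sum_infsum[OF norm_row] bound_sum bound] .
    also have "\<dots> \<le> \<mu> k * (1 + K\<^sup>2)"
      using K(1)[of "e k"] weight_pos[of k] by (intro mult_left_mono) (auto simp: power_mono)
    finally show ?thesis .
  qed
  then have "(\<lambda>k. \<Sum>\<^sub>\<infinity>x\<in>E. cmod (F k x)) summable_on UNIV"
    by (intro norm_summable_imp_summable_on summable_weight_bounded[where c = "1 + K\<^sup>2"])
      (simp add: infsum_nonneg)
  then have "(\<lambda>p. norm (case p of (k, x) \<Rightarrow> F k x)) summable_on (UNIV \<times> E)"
    by (subst Infinite_Sum.abs_summable_on_Sigma_iff) (simp add: norm_row infsum_nonneg)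
  then have "(\<lambda>(k, x). F k x) summable_on (UNIV \<times> E)"
    by (rule abs_summable_summable)
  then have "(\<Sum>\<^sub>\<infinity>k. \<Sum>\<^sub>\<infinity>x\<in>E. F k x) = (\<Sum>\<^sub>\<infinity>x\<in>E. \<Sum>\<^sub>\<infinity>k. F k x)"
    by (rule infsum_swap_banach)
  moreover have "(\<Sum>\<^sub>\<infinity>x\<in>E. F k x) = complex_of_real (\<mu> k) * cinner (e k) (A \<cdot> e k)" for k
    using row by (rule infsumI)
  moreover have "(\<Sum>\<^sub>\<infinity>k. F k x) = cinner x ((A * diagonal) \<cdot> x)" for x
  proof (rule infsumI, rule norm_summable_imp_has_sum)
    show "(\<lambda>k. F k x) sums cinner x ((A * diagonal) \<cdot> x)"
      using cinner_diagonal_sums[of x x A] by (simp add: F_def)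
    show "summable (\<lambda>k. norm (F k x))"
    proof (rule summable_weight_bounded)
      have "cmod (cinner (e k) x) * cmod (cinner x (A \<cdot> e k)) \<le> norm x * (norm x * K)" for k
        using cmod_cinner_le[of "e k" x] K(1)[of "e k"]
        by (intro mult_mono order_trans[OF cmod_cinner_le] mult_left_mono) auto
      then show "cmod (F k x) \<le> \<mu> k * (norm x * (norm x * K))" for k
        using weight_pos[of k] by (simp add: F_def norm_mult mult_left_mono)
    qed
  qed
  ultimately have trace: "trace (A * diagonal) = (\<Sum>\<^sub>\<infinity>k. complex_of_real (\<mu> k) * cinner (e k) (A \<cdot> e k))"
    unfolding trace_def E_def[symmetric] by simp
  have "cmod (complex_of_real (\<mu> k) * cinner (e k) (A \<cdot> e k)) \<le> \<mu> k * K" for k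
    using weight_pos[of k] cmod_cinner_le[of "e k" "A \<cdot> e k"] K(1)[of "e k"]
    by (auto simp: norm_mult intro: mult_left_mono)
  then have "(\<lambda>k. complex_of_real (\<mu> k) * cinner (e k) (A \<cdot> e k)) summable_on UNIV"
    by (intro norm_summable_imp_summable_on summable_weight_bounded[where c = K])
  then show ?thesis
    unfolding trace by (intro has_sum_imp_sums has_sum_infsum)
qed

section \<open>The normal functional of the diagonal operator\<close>

definition g :: "'h bop \<Rightarrow> complex" where
  "g A = trace (A * diagonal)"

lemma normal_g: "normal_functional g"
  unfolding normal_functional_def represents_def
  using trace_class_diagonal by (auto simp: g_def)

text \<open>These truncations serve as the approximants that show \<open>g\<close> to be almost
  dominated.\<close>

definition partial_g :: "nat \<Rightarrow> 'h bop \<Rightarrow> complex" where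
  "partial_g n A = (\<Sum>k<n. complex_of_real (\<mu> k) * cinner (e k) (A \<cdot> e k))"

lemma partial_g_tendsto: "(\<lambda>n. partial_g n A) \<longlonglongrightarrow> g A"
  using trace_mult_diagonal[of A] by (simp add: sums_def partial_g_def g_def)

lemma partial_g_self: "partial_g n (adj A * A) = complex_of_real (\<Sum>k<n. \<mu> k * (norm (A \<cdot> e k))\<^sup>2)"
  by (simp add: partial_g_def cinner_self flip: cinner_adj)

lemma positive_partial_g: "positive_functional (partial_g n)"
  unfolding positive_functional_def
proof
  show "Vector_Spaces.linear scaleC (*) (partial_g n)"
    by (simp add: functional_linear_iff partial_g_def cinner_simps algebra_simps sum.distrib sum_distrib_left)
  show "\<forall>A. 0 \<le> partial_g n (adj A * A)"
    unfolding partial_g_self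
    by (auto simp: less_eq_complex_def intro!: sum_nonneg mult_nonneg_nonneg less_imp_le[OF weight_pos])
qed

lemma positive_g: "positive_functional g"
  by (rule positive_functional_limit[OF positive_partial_g partial_g_tendsto])

lemma g_self_sums: "(\<lambda>k. \<mu> k * (norm (A \<cdot> e k))\<^sup>2) sums Re (g (adj A * A))"
  using tendsto_Re[OF partial_g_tendsto[of "adj A * A"]] by (simp add: sums_def partial_g_self)

lemma partial_g_le_g: "functional_le (partial_g n) g"
  unfolding functional_le_iff[OF positive_partial_g positive_g] partial_g_self Re_complex_of_real
  by (intro allI sum_le_sums g_self_sums mult_nonneg_nonneg less_imp_le[OF weight_pos] zero_le_power2)

section \<open>A vector functional below the diagonal one\<close>

definition \<eta> :: 'h where
  "\<eta> = (\<Sum>k. complex_of_real (\<mu> k) *\<^sub>C e k)"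

lemma \<eta>_sums: "(\<lambda>k. complex_of_real (\<mu> k) *\<^sub>C e k) sums \<eta>"
  unfolding \<eta>_def using weight_pos
  by (intro summable_sums summable_weight_bounded[where c = 1]) (simp add: norm_scaleC less_imp_le)

lemma cinner_e_\<eta>: "cinner (e k) \<eta> = complex_of_real (\<mu> k)"
proof -
  have "(\<lambda>j. cinner (e k) (complex_of_real (\<mu> j) *\<^sub>C e j)) sums cinner (e k) \<eta>"
    by (rule bounded_linear.sums[OF bounded_bilinear.bounded_linear_right[OF bounded_bilinear_cinner] \<eta>_sums])
  moreover have "(\<lambda>j. cinner (e k) (complex_of_real (\<mu> j) *\<^sub>C e j)) sums
      cinner (e k) (complex_of_real (\<mu> k) *\<^sub>C e k)"
    by (rule sums_finite[of "{k}", simplified]) (simp add: cinner_simps cinner_e)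
  ultimately show ?thesis by (simp add: sums_unique2 cinner_simps cinner_e)
qed

lemma \<eta>_nonzero: "\<eta> \<noteq> 0"
  using cinner_e_\<eta>[of 0] weight_pos[of 0] by auto

text \<open>Cauchy-Schwarz for the partial sums of \<open>A \<cdot> \<eta>\<close>, with each weight
  split into two square roots; the leftover factor is a partial sum of the weights, at most
  1.\<close>

lemma norm_\<eta>_le_g: "(norm (A \<cdot> \<eta>))\<^sup>2 \<le> Re (g (adj A * A))"
proof (rule LIMSEQ_le_const2)
  let ?s = "\<lambda>n. \<Sum>k<n. complex_of_real (\<mu> k) *\<^sub>C A \<cdot> e k"
  have "?s \<longlonglongrightarrow> A \<cdot> \<eta>"
    using bounded_linear.sums[OF bop_bounded_linear[of A] \<eta>_sums] by (simp add: sums_def bop_scaleC)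
  then show "(\<lambda>n. (norm (?s n))\<^sup>2) \<longlonglongrightarrow> (norm (A \<cdot> \<eta>))\<^sup>2"
    by (intro tendsto_intros)
  have "(norm (?s n))\<^sup>2 \<le> Re (g (adj A * A))" for n
  proof -
    have "norm (?s n) \<le> (\<Sum>k<n. \<mu> k * norm (A \<cdot> e k))"
      using weight_pos by (intro sum_norm_le) (simp add: norm_scaleC abs_of_pos)
    also have "\<dots> = (\<Sum>k<n. sqrt (\<mu> k) * (sqrt (\<mu> k) * norm (A \<cdot> e k)))"
      using weight_pos by (intro sum.cong) (simp_all add: less_imp_le flip: mult.assoc)
    finally have "(norm (?s n))\<^sup>2 \<le> (\<Sum>k<n. sqrt (\<mu> k) * (sqrt (\<mu> k) * norm (A \<cdot> e k)))\<^sup>2"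
      by (rule power_mono) simp
    also have "\<dots> \<le> (\<Sum>k<n. (sqrt (\<mu> k))\<^sup>2) * (\<Sum>k<n. (sqrt (\<mu> k) * norm (A \<cdot> e k))\<^sup>2)"
      by (rule Cauchy_Schwarz_ineq_sum)
    also have "\<dots> = (\<Sum>k<n. \<mu> k) * (\<Sum>k<n. \<mu> k * (norm (A \<cdot> e k))\<^sup>2)"
      using weight_pos by (simp add: power_mult_distrib less_imp_le)
    also have "\<dots> \<le> 1 * Re (g (adj A * A))"
      using weight_pos weight_sums g_self_sums[of A]
      by (intro mult_mono sum_le_sums sum_nonneg) (auto simp: less_imp_le)
    finally show ?thesis by simp
  qed
  then show "\<exists>N. \<forall>n\<ge>N. (norm (?s n))\<^sup>2 \<le> Re (g (adj A * A))" by blast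
qed

text \<open>The factor 1/2 leaves at least half of \<open>g\<close> in \<open>g - g1\<close>, so
  that the difference is equivalent to \<open>g\<close>.\<close>

definition g1 :: "'h bop \<Rightarrow> complex" where
  "g1 A = complex_of_real (1/2) * cinner \<eta> (A \<cdot> \<eta>)"

lemma g1_self: "g1 (adj A * A) = complex_of_real ((norm (A \<cdot> \<eta>))\<^sup>2 / 2)"
  by (simp add: g1_def cinner_self flip: cinner_adj)

lemma positive_g1: "positive_functional g1"
  unfolding positive_functional_def
proof
  show "Vector_Spaces.linear scaleC (*) g1"
    by (simp add: functional_linear_iff g1_def cinner_simps algebra_simps)
  show "\<forall>A. 0 \<le> g1 (adj A * A)"
    unfolding g1_self by (simp add: less_eq_complex_def)
qed

lemma g1_nonzero: "g1 \<noteq> (\<lambda>A. 0)"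
proof
  assume "g1 = (\<lambda>A. 0)"
  then have "g1 1 = 0" by simp
  then show False using \<eta>_nonzero by (simp add: g1_def cinner_eq_zero_iff)
qed

lemma g1_le_half_g: "2 * Re (g1 (adj A * A)) \<le> Re (g (adj A * A))"
  using norm_\<eta>_le_g[of A] by (simp add: g1_self)

lemma g1_le_g: "functional_le g1 g"
  unfolding functional_le_iff[OF positive_g1 positive_g]
proof
  fix A
  have "0 \<le> Re (g1 (adj A * A))" by (simp add: g1_self)
  then show "Re (g1 (adj A * A)) \<le> Re (g (adj A * A))" using g1_le_half_g[of A] by linarith
qed

text \<open>Every truncation involves finitely many vectors of the range of \<open>T\<close>, so it
  is dominated by a multiple of \<open>f\<close>; the constants may grow with
  \<open>n\<close>.\<close>

lemma closable_g:
  assumes f: "positive_functional f" "represents T f" and range: "range e \<subseteq> range (apply_bop T)"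
  shows "closable f g"
proof -
  interpret f: represented_functional f T by unfold_locales fact+
  have "\<exists>c\<ge>0. \<forall>A. norm (A \<cdot> e k) \<le> c * f.seminorm A" for k
    using f.range_bounded[of "e k"] range by (metis rangeI subsetD)
  then obtain c where c: "\<And>k. 0 \<le> c k" "\<And>k A. norm (A \<cdot> e k) \<le> c k * f.seminorm A" by metis
  have "Re (partial_g n (adj A * A)) \<le> (\<Sum>k<n. \<mu> k * (c k)\<^sup>2) * Re (f (adj A * A))" for n A
  proof -
    have "Re (partial_g n (adj A * A)) \<le> (\<Sum>k<n. \<mu> k * (c k * f.seminorm A)\<^sup>2)"
      unfolding partial_g_self Re_complex_of_real
      by (intro sum_mono mult_left_mono power_mono c less_imp_le[OF weight_pos]) simp
    then show ?thesis
      by (simp add: power_mult_distrib f.seminorm_power2 sum_distrib_right mult.assoc)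
  qed
  then show ?thesis
    by (rule closable_if_almost_dominated[OF f(1) positive_g positive_partial_g partial_g_le_g _ partial_g_tendsto])
qed

text \<open>
  The operator \<open>rank1 \<eta> (e k)\<close> maps \<open>\<eta>\<close> to \<open>\<mu> k\<close> times itself, so a minorant of \<open>g1\<close> does not
  distinguish it from \<open>\<mu> k\<close> times the identity, whereas \<open>f\<close> is small on it.
\<close>

lemma singular_g1:
  assumes f: "positive_functional f"
    and small: "(\<lambda>k. Re (f (rank1 (e k) (e k))) / (\<mu> k)\<^sup>2) \<longlonglongrightarrow> 0"
  shows "mutually_singular f g1"
  unfolding mutually_singular_def
proof (intro allI impI)
  interpret f: pos_functional f by standard fact
  fix h assume h: "positive_functional h" "functional_le h f" "functional_le h g1"
  interpret h: pos_functional h by standard fact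
  have "(h.seminorm 1)\<^sup>2 \<le> (norm \<eta>)\<^sup>2 * (Re (f (rank1 (e k) (e k))) / (\<mu> k)\<^sup>2)" for k
  proof -
    define B where "B = rank1 \<eta> (e k)"
    let ?D = "B - complex_of_real (\<mu> k) *\<^sub>C 1"
    have "?D \<cdot> \<eta> = 0" by (simp add: B_def cinner_e_\<eta>)
    then have "Re (g1 (adj ?D * ?D)) = 0" by (simp only: g1_self) simp
    then have "Re (h (adj ?D * ?D)) \<le> 0"
      using h(3) unfolding functional_le_iff[OF h(1) positive_g1] by metis
    then have "h.seminorm ?D = 0"
      using h.Re_nonneg[of ?D] by (simp add: h.seminorm_def del: adj_simps)
    then have "h.seminorm B = h.seminorm (complex_of_real (\<mu> k) *\<^sub>C 1)"
      by (rule h.seminorm_eq_if_diff_null)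
    also have "\<dots> = \<mu> k * h.seminorm 1"
      using weight_pos[of k] by (simp only: h.seminorm_scale) simp
    \<comment> \<open>Comparison with \<open>f\<close> now bounds \<open>h\<close> at 1 by
      \<open>f\<close> at \<open>rank1 (e k) (e k)\<close> divided by
      \<open>(\<mu> k)\<^sup>2\<close>, which tends to 0; a positive functional vanishing at 1 is
      zero.\<close>
    finally have "(\<mu> k)\<^sup>2 * (h.seminorm 1)\<^sup>2 = Re (h (adj B * B))"
      using h.seminorm_power2[of B] by (simp add: power_mult_distrib)
    also have "\<dots> \<le> Re (f (adj B * B))"
      using h(2) unfolding functional_le_iff[OF h(1) f] by blast
    also have "\<dots> = (norm \<eta>)\<^sup>2 * Re (f (rank1 (e k) (e k)))"
      by (simp add: B_def rank1_mult_rank1 f.scale cinner_self del: of_real_power)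
    finally show ?thesis using weight_pos[of k] by (simp add: field_simps)
  qed
  moreover have "(\<lambda>k. (norm \<eta>)\<^sup>2 * (Re (f (rank1 (e k) (e k))) / (\<mu> k)\<^sup>2)) \<longlonglongrightarrow> (norm \<eta>)\<^sup>2 * 0"
    by (intro tendsto_mult tendsto_const small)
  ultimately have "(h.seminorm 1)\<^sup>2 \<le> (norm \<eta>)\<^sup>2 * 0"
    by (intro LIMSEQ_le_const) auto
  then have "h.seminorm 1 = 0" by simp
  then show "h = (\<lambda>A. 0)" using h.Cauchy_Schwarz_one by (simp add: fun_eq_iff)
qed

end

text \<open>Closability depends only on which sequences are null or Cauchy, and
  \<open>k \<le> g \<le> C k\<close> makes these the same for \<open>g\<close> and
  \<open>k\<close>.\<close>

lemma closable_equivalent: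
  assumes "closable f g" "positive_functional g" and k: "positive_functional k"
    and le: "\<And>A. Re (k (adj A * A)) \<le> Re (g (adj A * A))"
    and ge: "\<And>A. Re (g (adj A * A)) \<le> C * Re (k (adj A * A))"
  shows "closable f k"
  unfolding closable_def
proof (intro allI impI)
  interpret g: pos_functional g by standard fact
  interpret k: pos_functional k by standard fact
  have norm_g: "cmod (g (adj A * A)) = Re (g (adj A * A))" for A
    by (subst g.G_self) (simp add: g.seminorm_power2[symmetric] norm_power)
  have norm_k: "cmod (k (adj A * A)) = Re (k (adj A * A))" for A
    by (subst k.G_self) (simp add: k.seminorm_power2[symmetric] norm_power)
  fix A
  assume f0: "(\<lambda>n. f (adj (A n) * A n)) \<longlonglongrightarrow> 0"
    and k0: "((\<lambda>(n, m). k (adj (A n - A m) * (A n - A m))) \<longlongrightarrow> 0) (sequentially \<times>\<^sub>F sequentially)"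
  have "((\<lambda>p. C * cmod (case p of (n, m) \<Rightarrow> k (adj (A n - A m) * (A n - A m)))) \<longlongrightarrow> C * 0)
      (sequentially \<times>\<^sub>F sequentially)"
    by (intro tendsto_mult tendsto_const tendsto_norm_zero k0)
  then have "((\<lambda>(n, m). g (adj (A n - A m) * (A n - A m))) \<longlongrightarrow> 0) (sequentially \<times>\<^sub>F sequentially)"
    unfolding mult_zero_right
    by (rule Lim_null_comparison[OF always_eventually, rotated])
      (simp add: norm_g norm_k ge case_prod_unfold del: adj_simps)
  then have "(\<lambda>n. g (adj (A n) * A n)) \<longlonglongrightarrow> 0"
    using assms(1) f0 unfolding closable_def by blast
  then have "(\<lambda>n. cmod (g (adj (A n) * A n))) \<longlonglongrightarrow> 0"
    by (rule tendsto_norm_zero)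
  then show "(\<lambda>n. k (adj (A n) * A n)) \<longlonglongrightarrow> 0"
    by (rule Lim_null_comparison[OF always_eventually, rotated]) (simp add: norm_g norm_k le)
qed

lemma mutually_singular_zero: "mutually_singular f (\<lambda>A. 0)"
  unfolding mutually_singular_def
  by (auto simp: functional_le_def less_eq_complex_def intro!: eq_zero_if_Re_le_0)

lemma positive_functional_zero: "positive_functional (\<lambda>A. 0)"
  by (simp add: positive_functional_def functional_linear_iff)

section \<open>Infinite rank\<close>

text \<open>A finite maximal orthonormal system in the range would span it, so a maximal one is
  infinite.\<close>

lemma infinite_rank_orthonormal_sequence:
  assumes "\<not> finite_rank T"
  obtains e :: "nat \<Rightarrow> 'h::chilbert_space"
  where "inj e" "orthonormal (range e)" "range e \<subseteq> range (apply_bop T)"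
proof -
  obtain E where E: "orthonormal E" "E \<subseteq> range (apply_bop T)"
    and max: "\<And>x. x \<in> range (apply_bop T) \<Longrightarrow> (\<And>e. e \<in> E \<Longrightarrow> cinner e x = 0) \<Longrightarrow> x = 0"
    using exists_maximal_orthonormal[OF subspace_range, of "{}" T] by (auto simp: orthonormal_def)
  have "infinite E"
    using span_maximal_orthonormal[OF subspace_range E] max assms by (auto simp: finite_rank_def)
  then obtain e :: "nat \<Rightarrow> 'h" where "inj e" "range e \<subseteq> E"
    using infinite_countable_subset by blast
  then show thesis using E orthonormal_subset by (intro that[of e]) auto
qed

text \<open>The partial sums of \<open>rank1 (e k) (e k)\<close> are projections \<open>P\<close>,
  and positivity at \<open>1 - P\<close> bounds \<open>f P\<close> by \<open>f 1\<close>; the values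
  are therefore summable.\<close>

lemma rank1_self_tendsto_0:
  fixes e :: "nat \<Rightarrow> 'h::chilbert_space"
  assumes "positive_functional f" "inj e" "orthonormal (range e)"
  shows "(\<lambda>n. Re (f (rank1 (e n) (e n)))) \<longlonglongrightarrow> 0"
proof (rule summable_LIMSEQ_zero)
  interpret f: pos_functional f by standard fact
  have e: "cinner (e j) (e k) = (if j = k then 1 else 0)" for j k
    using orthonormal_cinner[OF assms(3), of "e j" "e k"] assms(2) by (simp add: inj_eq)
  show "summable (\<lambda>n. Re (f (rank1 (e n) (e n))))"
  proof (rule summableI_nonneg_bounded)
    show "0 \<le> Re (f (rank1 (e n) (e n)))" for n
      using f.Re_nonneg[of "rank1 (e n) (e n)"] by (simp add: rank1_mult_rank1 e scaleC_one)
    show "(\<Sum>k<n. Re (f (rank1 (e k) (e k)))) \<le> Re (f 1)" for n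
    proof -
      define P where "P = (\<Sum>k<n. rank1 (e k) (e k))"
      have "adj (\<Sum>k<m. rank1 (e k) (e k)) = (\<Sum>k<m. rank1 (e k) (e k))" for m
        by (induction m) simp_all
      then have "adj P = P" by (simp add: P_def)
      have "P * rank1 (e j) (e j) = rank1 (e j) (e j)" if "j < n" for j
      proof -
        have "P * rank1 (e j) (e j) = (\<Sum>k<n. if k = j then rank1 (e j) (e j) else 0)"
          unfolding P_def sum_distrib_right
          by (rule sum.cong) (simp_all add: rank1_mult_rank1 e scaleC_one)
        then show ?thesis using that by simp
      qed
      then have "P * P = P" by (simp add: P_def sum_distrib_left)
      have "0 \<le> Re (f (adj (1 - P) * (1 - P)))" by (rule f.Re_nonneg)
      also have "adj (1 - P) * (1 - P) = 1 - P"
        by (simp add: \<open>adj P = P\<close> \<open>P * P = P\<close> algebra_simps)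
      finally show ?thesis by (simp add: P_def f.diff f.sum)
    qed
  qed
qed

lemma fast_subsequence:
  fixes t b :: "nat \<Rightarrow> real"
  assumes "t \<longlonglongrightarrow> 0" "\<And>k. 0 < b k"
  obtains r :: "nat \<Rightarrow> nat" where "strict_mono r" "\<And>k. t (r k) < b k"
proof -
  have ev: "\<exists>n>m. t n < b k" for k m
  proof -
    have "\<forall>\<^sub>F n in sequentially. t n < b k \<and> m < n"
      using order_tendstoD(2)[OF assms(1) assms(2)[of k]] eventually_gt_at_top[of m]
      by (rule eventually_conj)
    then show ?thesis by (auto dest: eventually_happens)
  qed
  have "\<exists>r. \<forall>k. t (r k) < b k \<and> r k < r (Suc k)"
    by (rule dependent_nat_choice) (use ev in blast)+
  then obtain r where "\<And>k. t (r k) < b k" "\<And>k. r k < r (Suc k)" by blast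
  then show thesis using that[of r] by (simp add: strict_mono_Suc_iff)
qed

theorem nonunique_decomposition_if_infinite_rank:
  fixes f :: "'h::chilbert_space bop \<Rightarrow> complex"
  assumes f: "positive_functional f" "represents T f" and "\<not> finite_rank T"
  shows "\<exists>g. positive_functional g \<and> normal_functional g \<and>
    (\<exists>p q. lebesgue_decomposition f g p \<and> lebesgue_decomposition f g q \<and> p \<noteq> q)"
proof -
  interpret f: represented_functional f T by unfold_locales fact+
  obtain d :: "nat \<Rightarrow> 'h" where d: "inj d" "orthonormal (range d)" "range d \<subseteq> range (apply_bop T)"
    using infinite_rank_orthonormal_sequence[OF assms(3)] .
  \<comment> \<open>The rate \<open>(1/8) ^ k\<close> still tends to 0 after division by
    \<open>(\<mu> k)\<^sup>2 = (1/4) ^ Suc k\<close>: the quotient is below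
    \<open>4 * (1/2) ^ k\<close>.\<close>
  obtain r where r: "strict_mono r" "\<And>k. Re (f (rank1 (d (r k)) (d (r k)))) < (1/8) ^ k"
    using fast_subsequence[OF rank1_self_tendsto_0[OF f(1) d(1,2)], of "\<lambda>k. (1/8) ^ k"] by auto
  define e where "e = d \<circ> r"
  define \<mu> :: "nat \<Rightarrow> real" where "\<mu> k = (1/2) ^ Suc k" for k
  interpret diagonal_weights e \<mu>
  proof
    show "inj e" unfolding e_def using d(1) strict_mono_imp_inj_on[OF r(1)] by (rule inj_compose)
    show "orthonormal (range e)" by (rule orthonormal_subset[OF d(2)]) (auto simp: e_def)
    show "\<mu> sums 1" unfolding \<mu>_def by (rule power_half_series)
  qed (simp add: \<mu>_def)
  have "closable f g" by (rule closable_g[OF f]) (use d(3) in \<open>auto simp: e_def\<close>)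
  have "mutually_singular f g1"
  proof (rule singular_g1[OF f(1)], rule tendsto_sandwich[OF _ _ tendsto_const])
    show "\<forall>\<^sub>F k in sequentially. 0 \<le> Re (f (rank1 (e k) (e k))) / (\<mu> k)\<^sup>2"
      using f.Re_nonneg[of "rank1 (e _) (e _)"]
      by (intro always_eventually allI divide_nonneg_nonneg) (simp_all add: rank1_mult_rank1 cinner_e scaleC_one)
    show "\<forall>\<^sub>F k in sequentially. Re (f (rank1 (e k) (e k))) / (\<mu> k)\<^sup>2 \<le> 4 * (1/2) ^ k"
    proof (intro always_eventually allI)
      fix k
      have "(4 * (1/2) ^ k) * (\<mu> k)\<^sup>2 = ((1/2) ^ 3) ^ k"
        unfolding \<mu>_def power_mult[symmetric] by (simp add: power2_eq_square mult.commute[of 3] power_add[symmetric] numeral_eq_Suc)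
      then show "Re (f (rank1 (e k) (e k))) / (\<mu> k)\<^sup>2 \<le> 4 * (1/2) ^ k"
        using r(2)[of k] weight_pos[of k] by (simp add: e_def divide_le_eq power3_eq_cube)
    qed
    have "(\<lambda>k. 4 * (1/2) ^ k :: real) \<longlonglongrightarrow> 4 * 0"
      by (intro tendsto_mult tendsto_const LIMSEQ_power_zero) simp
    then show "(\<lambda>k. 4 * (1/2) ^ k :: real) \<longlonglongrightarrow> 0" by simp
  qed
  have pos: "positive_functional (\<lambda>A. g A - g1 A)"
    by (rule positive_functional_diff[OF positive_g positive_g1 g1_le_g])
  \<comment> \<open>Since \<open>2 * g1 \<le> g\<close>, the difference lies between half of
    \<open>g\<close> and \<open>g\<close>, and so inherits closability from
    \<open>g\<close>.\<close>
  have "closable f (\<lambda>A. g A - g1 A)"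
  proof (rule closable_equivalent[OF \<open>closable f g\<close> positive_g pos])
    fix A
    show "Re (g (adj A * A) - g1 (adj A * A)) \<le> Re (g (adj A * A))" by (simp add: g1_self)
    show "Re (g (adj A * A)) \<le> 2 * Re (g (adj A * A) - g1 (adj A * A))"
      using g1_le_half_g[of A] by simp
  qed
  then have "lebesgue_decomposition f g (\<lambda>A. g A - g1 A, g1)"
    using pos \<open>mutually_singular f g1\<close> by (simp add: lebesgue_decomposition_def positive_g1)
  moreover have "lebesgue_decomposition f g (g, \<lambda>A. 0)"
    using \<open>closable f g\<close>
    by (simp add: lebesgue_decomposition_def positive_g positive_functional_zero mutually_singular_zero)
  moreover have "(\<lambda>A. g A - g1 A, g1) \<noteq> (g, \<lambda>A. 0)" using g1_nonzero by simp
  ultimately show ?thesis using positive_g normal_g by blast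
qed

theorem theorem2p3:
  fixes f :: "'h::chilbert_space bop \<Rightarrow> complex" and T :: "'h bop"
  assumes "positive_functional f" and "normal_functional f"
    and "positive_op T" and "represents T f"
  shows "(finite_rank T \<longrightarrow>
            (\<forall>g. positive_functional g \<and> normal_functional g \<longrightarrow>
              (\<exists>!p. lebesgue_decomposition f g p))) \<and>
         (\<not> finite_rank T \<longrightarrow>
            (\<exists>g. positive_functional g \<and> normal_functional g \<and>
              (\<exists>p q. lebesgue_decomposition f g p \<and> lebesgue_decomposition f g q \<and> p \<noteq> q)))"
  using unique_decomposition_if_finite_rank[OF assms(1,4)]
    nonunique_decomposition_if_infinite_rank[OF assms(1,4)] by blast

end
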